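(* The group $N_{3,4}$ does not admit a faithful state-closed representation on the $m$-ary rooted tree $\mathcal{T}_m$ for any $m \geq 1$; that is, for every $m \geq 1$, there is no injective homomorphism $N_{3,4} \to \mathrm{Aut}(\mathcal{T}_m)$ whose image is a state-closed subgroup of $\mathrm{Aut}(\mathcal{T}_m)$ (whether or not the action on the first level of the tree is transitive).
   Context: Commutators: $[x,y] = x^{-1}y^{-1}xy$ and $[x,y,z] = [[x,y],z]$. The group $N_{3,4}$ is the nilpotent group of class $3$ generated by $a,b,c,d$ with the following defining relations (i.e. the quotient of the free nilpotent group of class $3$ on $a,b,c,d$ by the normal closure of these relators): $$[a,[a,b]] = [a,b,b] = [a,[c,d]] = [a,d,d] = 1,$$ $$[b,[b,c]] = [b,[c,d]] = [c,[c,d]] = [c,d,d] = 1,$$ $$[a,[b,c]]\cdot[a,c,b] = [a,[b,d]]\cdot[a,d,b] = 1,$$ $$[a,[a,d]]\cdot[b,c,c]^{-1} = [a,[a,c]]\cdot[b,[b,d]]^{-1} = 1,$$ $$[a,c,b]\cdot[b,d,d]^{-1} = [a,c,c]\cdot[b,d,c]^{-1} = [a,d,b]\cdot[a,d,c]^{-1} = 1,$$ $$[a,b]\cdot[a,c,c]^{-1} = [c,d]\cdot[a,[a,c]]^{-1} = 1.$$ Trees and state-closed groups: let $Y = \{0,\dots,m-1\}$; the set $Y^{*}$ of finite words over $Y$ is naturally an $m$-ary rooted tree $\mathcal{T}_m$. The automorphism group $\mathcal{A}_m = \mathrm{Aut}(\mathcal{T}_m)$ satisfies $\mathcal{A}_m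 \cong \mathcal{A}_m \wr \mathrm{Perm}(Y)$: each $\alpha \in \mathcal{A}_m$ is written $\alpha = (\alpha_0,\dots,\alpha_{m-1})\sigma(\alpha)$, with $\alpha_i \in \mathcal{A}_m$ and $\sigma(\alpha) \in \mathrm{Perm}(Y)$ the action on the first level, where $\alpha$ sends a word $y_1 y_2 \cdots y_n$ to $(y_1)^{\sigma(\alpha)} (y_2 \cdots y_n)^{\alpha_{y_1}}$. The set of states of $\alpha$ is defined recursively by $Q(\alpha) = \{\alpha\} \cup Q(\alpha_0) \cup \cdots \cup Q(\alpha_{m-1})$. A subgroup $G \leqslant \mathcal{A}_m$ is state-closed (self-similar) if $Q(\alpha) \subseteq G$ for all $\alpha \in G$. *)

theory Defs
  imports "HOL-Algebra.Generated_Groups" "HOL-Algebra.Bij"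
begin

section \<open>Free groups\<close>

text \<open>A word is a list of letters; the letter \<open>(x, True)\<close> stands for the
  generator \<open>x\<close> and \<open>(x, False)\<close> for its inverse.  Free equivalence is generated by
  insertion and deletion of cancelling pairs.\<close>

inductive free_eq :: "('a \<times> bool) list \<Rightarrow> ('a \<times> bool) list \<Rightarrow> bool" where
  free_eq_refl: "free_eq u u"
| free_eq_sym: "free_eq u v \<Longrightarrow> free_eq v u"
| free_eq_trans: "free_eq u v \<Longrightarrow> free_eq v w \<Longrightarrow> free_eq u w"
| free_eq_cancel: "free_eq (u @ [(x, e), (x, \<not> e)] @ v) (u @ v)"

definition free_class :: "('a \<times> bool) list \<Rightarrow> ('a \<times> bool) list set" where
  "free_class u = {v. free_eq u v}"

definition free_group :: "('a \<times> bool) list set monoid" where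
  "free_group = \<lparr>carrier = range free_class,
                 mult = (\<lambda>P Q. \<Union>u\<in>P. \<Union>v\<in>Q. free_class (u @ v)),
                 one = free_class []\<rparr>"

definition free_gen :: "'a \<Rightarrow> ('a \<times> bool) list set" where
  "free_gen x = free_class [(x, True)]"

lemma free_eq_append_left: "free_eq u v \<Longrightarrow> free_eq (w @ u) (w @ v)"
proof (induction rule: free_eq.induct)
  case (free_eq_cancel u x e v)
  show ?case using free_eq.free_eq_cancel[of "w @ u" x e v] by simp
qed (auto intro: free_eq.intros)

lemma free_eq_append_right: "free_eq u v \<Longrightarrow> free_eq (u @ w) (v @ w)"
proof (induction rule: free_eq.induct)
  case (free_eq_cancel u x e v)
  show ?case using free_eq.free_eq_cancel[of u x e "v @ w"] by simp
qed (auto intro: free_eq.intros)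

lemma free_eq_append: "free_eq u u' \<Longrightarrow> free_eq v v' \<Longrightarrow> free_eq (u @ v) (u' @ v')"
  by (meson free_eq_append_left free_eq_append_right free_eq_trans)

lemma free_class_eq_iff: "free_class u = free_class v \<longleftrightarrow> free_eq u v"
  unfolding free_class_def by (auto intro: free_eq.intros)

lemma free_class_self: "u \<in> free_class u"
  by (simp add: free_class_def free_eq_refl)

lemma free_group_mult:
  "free_class u \<otimes>\<^bsub>free_group\<^esub> free_class v = free_class (u @ v)"
proof -
  have *: "free_class (u' @ v') = free_class (u @ v)"
    if "u' \<in> free_class u" "v' \<in> free_class v" for u' v'
    using that by (metis free_class_def free_class_eq_iff free_eq_append free_eq_sym mem_Collect_eq)
  have "free_class u \<otimes>\<^bsub>free_group\<^esub> free_class v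
      = (\<Union>u'\<in>free_class u. \<Union>v'\<in>free_class v. free_class (u' @ v'))"
    by (simp add: free_group_def)
  also have "\<dots> = (\<Union>u'\<in>free_class u. \<Union>v'\<in>free_class v. free_class (u @ v))"
    using * by simp
  also have "\<dots> = free_class (u @ v)"
    using free_class_self[of u] free_class_self[of v] by auto
  finally show ?thesis .
qed

lemma free_eq_inverse:
  "free_eq (rev (map (\<lambda>(x, e). (x, \<not> e)) u) @ u) []"
proof (induction u)
  case (Cons l u)
  obtain x e where l: "l = (x, e)" by (cases l)
  let ?r = "rev (map (\<lambda>(x, e). (x, \<not> e)) u)"
  have "free_eq (?r @ [(x, \<not> e), (x, \<not> \<not> e)] @ u) (?r @ u)"
    by (rule free_eq_cancel)
  then show ?case using Cons l by (auto intro: free_eq_trans)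
qed (simp add: free_eq_refl)

lemma free_group_carrier: "carrier free_group = range free_class"
  by (simp add: free_group_def)

lemma free_group_one: "\<one>\<^bsub>free_group\<^esub> = free_class []"
  by (simp add: free_group_def)

theorem group_free_group: "group free_group"
proof (rule groupI)
  fix P :: "('a \<times> bool) list set" assume "P \<in> carrier free_group"
  then obtain u where P: "P = free_class u" by (auto simp: free_group_carrier)
  let ?v = "free_class (rev (map (\<lambda>(x, e). (x, \<not> e)) u))"
  have "?v \<otimes>\<^bsub>free_group\<^esub> P = \<one>\<^bsub>free_group\<^esub>"
    by (simp add: P free_group_mult free_group_one free_class_eq_iff free_eq_inverse)
  then show "\<exists>Q\<in>carrier free_group. Q \<otimes>\<^bsub>free_group\<^esub> P = \<one>\<^bsub>free_group\<^esub>"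
    by (auto simp: free_group_carrier)
qed (auto simp: free_group_carrier free_group_mult free_group_one)

section \<open>Commutators, lower central series, normal closure\<close>

text \<open>The convention is \<open>[x, y] = x\<^sup>-\<^sup>1 y\<^sup>-\<^sup>1 x y\<close>, with left-normed
  \<open>[x, y, z] = [[x, y], z]\<close>.\<close>

definition commutator :: "('g, 'm) monoid_scheme \<Rightarrow> 'g \<Rightarrow> 'g \<Rightarrow> 'g" where
  "commutator G x y = inv\<^bsub>G\<^esub> x \<otimes>\<^bsub>G\<^esub> inv\<^bsub>G\<^esub> y \<otimes>\<^bsub>G\<^esub> x \<otimes>\<^bsub>G\<^esub> y"

definition commutator3 :: "('g, 'm) monoid_scheme \<Rightarrow> 'g \<Rightarrow> 'g \<Rightarrow> 'g \<Rightarrow> 'g" where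
  "commutator3 G x y z = commutator G (commutator G x y) z"

text \<open>The numbering starts at \<open>0\<close>: \<open>lower_central G c\<close> is the term usually written
  \<open>\<gamma>\<close> with index \<open>c + 1\<close>, so that \<open>G Mod lower_central G c\<close> is the largest quotient of
  nilpotency class at most \<open>c\<close>.\<close>

primrec lower_central :: "('g, 'm) monoid_scheme \<Rightarrow> nat \<Rightarrow> 'g set" where
  "lower_central G 0 = carrier G"
| "lower_central G (Suc n) =
     generate G {commutator G x y | x y. x \<in> lower_central G n \<and> y \<in> carrier G}"

definition normal_closure :: "('g, 'm) monoid_scheme \<Rightarrow> 'g set \<Rightarrow> 'g set" where
  "normal_closure G S = \<Inter>{N. N \<lhd> G \<and> S \<subseteq> N}"

context group
begin

lemma commutator_closed [simp]:
  "x \<in> carrier G \<Longrightarrow> y \<in> carrier G \<Longrightarrow> commutator G x y \<in> carrier G"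
  by (simp add: commutator_def)

lemma conj_commutator:
  assumes "x \<in> carrier G" "y \<in> carrier G" "g \<in> carrier G"
  shows "g \<otimes> commutator G x y \<otimes> inv g
       = commutator G (g \<otimes> x \<otimes> inv g) (g \<otimes> y \<otimes> inv g)"
proof -
  have cancel: "inv g \<otimes> (g \<otimes> z) = z" if "z \<in> carrier G" for z
    using that assms(3) by (simp flip: m_assoc)
  show ?thesis using assms by (simp add: commutator_def inv_mult_group m_assoc cancel)
qed

lemma normal_lower_central: "lower_central G n \<lhd> G"
proof (induction n)
  case 0
  show ?case by (simp add: normal_inv_iff subgroup_self)
next
  case (Suc n)
  let ?L = "lower_central G n"
  let ?S = "{commutator G x y | x y. x \<in> ?L \<and> y \<in> carrier G}"
  interpret L: normal ?L G by (rule Suc)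
  have "?S \<subseteq> carrier G" using L.subset by auto
  then have "generate G ?S \<lhd> G"
  proof (rule normal_generateI)
    fix h g assume "h \<in> ?S" and g: "g \<in> carrier G"
    then obtain x y where h: "h = commutator G x y" "x \<in> ?L" "y \<in> carrier G" by blast
    have "g \<otimes> h \<otimes> inv g = commutator G (g \<otimes> x \<otimes> inv g) (g \<otimes> y \<otimes> inv g)"
      using h g L.subset by (auto intro: conj_commutator)
    moreover have "g \<otimes> x \<otimes> inv g \<in> ?L" using h g by (simp add: L.inv_op_closed2)
    ultimately show "g \<otimes> h \<otimes> inv g \<in> ?S" using h g by blast
  qed
  then show ?case by simp
qed

lemma normal_normal_closure:
  assumes "S \<subseteq> carrier G"
  shows "normal_closure G S \<lhd> G"
proof -
  let ?A = "{N. N \<lhd> G \<and> S \<subseteq> N}"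
  have ne: "carrier G \<in> ?A" using assms by (simp add: normal_inv_iff subgroup_self)
  have "subgroup (\<Inter>?A) G"
    using ne by (intro subgroups_Inter) (auto dest: normal_imp_subgroup)
  moreover have "g \<otimes> h \<otimes> inv g \<in> \<Inter>?A" if "g \<in> carrier G" "h \<in> \<Inter>?A" for g h
    using that by (auto intro: normal.inv_op_closed2)
  ultimately show ?thesis by (auto simp: normal_inv_iff normal_closure_def)
qed

end

section \<open>The group $N_{3,4}$\<close>

datatype gen4 = GenA | GenB | GenC | GenD

definition free_nilpotent :: "nat \<Rightarrow> ('a \<times> bool) list set set monoid" where
  "free_nilpotent c = free_group Mod lower_central free_group c"

definition free_nilpotent_gen :: "nat \<Rightarrow> 'a \<Rightarrow> ('a \<times> bool) list set set" where
  "free_nilpotent_gen c x = lower_central free_group c #>\<^bsub>free_group\<^esub> free_gen x"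

definition relators34 :: "('g, 'm) monoid_scheme \<Rightarrow> 'g \<Rightarrow> 'g \<Rightarrow> 'g \<Rightarrow> 'g \<Rightarrow> 'g set" where
  "relators34 G a b c d =
    (let K = commutator G; K3 = commutator3 G in
     {K a (K a b), K3 a b b, K a (K c d), K3 a d d,
      K b (K b c), K b (K c d), K c (K c d), K3 c d d,
      K a (K b c) \<otimes>\<^bsub>G\<^esub> K3 a c b,
      K a (K b d) \<otimes>\<^bsub>G\<^esub> K3 a d b,
      K a (K a d) \<otimes>\<^bsub>G\<^esub> inv\<^bsub>G\<^esub> (K3 b c c),
      K a (K a c) \<otimes>\<^bsub>G\<^esub> inv\<^bsub>G\<^esub> (K b (K b d)),
      K3 a c b \<otimes>\<^bsub>G\<^esub> inv\<^bsub>G\<^esub> (K3 b d d),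
      K3 a c c \<otimes>\<^bsub>G\<^esub> inv\<^bsub>G\<^esub> (K3 b d c),
      K3 a d b \<otimes>\<^bsub>G\<^esub> inv\<^bsub>G\<^esub> (K3 a d c),
      K a b \<otimes>\<^bsub>G\<^esub> inv\<^bsub>G\<^esub> (K3 a c c),
      K c d \<otimes>\<^bsub>G\<^esub> inv\<^bsub>G\<^esub> (K a (K a c))})"

definition N34 :: "(gen4 \<times> bool) list set set set monoid" where
  "N34 = free_nilpotent 3 Mod normal_closure (free_nilpotent 3)
     (relators34 (free_nilpotent 3)
        (free_nilpotent_gen 3 GenA) (free_nilpotent_gen 3 GenB)
        (free_nilpotent_gen 3 GenC) (free_nilpotent_gen 3 GenD))"

lemma group_free_nilpotent: "group (free_nilpotent c)"
  unfolding free_nilpotent_def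
  by (intro normal.factorgroup_is_group group.normal_lower_central group_free_group)

lemma free_nilpotent_gen_closed: "free_nilpotent_gen c x \<in> carrier (free_nilpotent c)"
  by (auto simp: free_nilpotent_def free_nilpotent_gen_def free_gen_def FactGroup_def
      RCOSETS_def free_group_carrier)

lemma (in group) relators34_closed:
  assumes "a \<in> carrier G" "b \<in> carrier G" "c \<in> carrier G" "d \<in> carrier G"
  shows "relators34 G a b c d \<subseteq> carrier G"
  using assms by (simp add: relators34_def commutator3_def Let_def)

theorem group_N34: "group N34"
  unfolding N34_def
  by (intro normal.factorgroup_is_group group.normal_normal_closure group.relators34_closed
      group_free_nilpotent free_nilpotent_gen_closed)

section \<open>The rooted tree and its automorphisms\<close>

definition tree_words :: "nat \<Rightarrow> nat list set" where
  "tree_words m = lists {..<m}"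

definition tree_adjacent :: "nat list \<Rightarrow> nat list \<Rightarrow> bool" where
  "tree_adjacent v w \<longleftrightarrow> (\<exists>y. w = v @ [y] \<or> v = w @ [y])"

definition tree_auts :: "nat \<Rightarrow> (nat list \<Rightarrow> nat list) set" where
  "tree_auts m = {\<alpha> \<in> Bij (tree_words m). \<alpha> [] = [] \<and>
     (\<forall>v\<in>tree_words m. \<forall>w\<in>tree_words m.
        tree_adjacent (\<alpha> v) (\<alpha> w) \<longleftrightarrow> tree_adjacent v w)}"

text \<open>Automorphisms act from the right, so the product \<open>\<alpha> \<beta>\<close> applies \<open>\<alpha>\<close> first.\<close>

definition tree_aut_group :: "nat \<Rightarrow> (nat list \<Rightarrow> nat list) monoid" where
  "tree_aut_group m = \<lparr>carrier = tree_auts m,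
                       mult = (\<lambda>\<alpha> \<beta>. compose (tree_words m) \<beta> \<alpha>),
                       one = (\<lambda>w\<in>tree_words m. w)\<rparr>"

definition first_level :: "(nat list \<Rightarrow> nat list) \<Rightarrow> nat \<Rightarrow> nat" where
  "first_level \<alpha> y = hd (\<alpha> [y])"

definition section_at :: "nat \<Rightarrow> (nat list \<Rightarrow> nat list) \<Rightarrow> nat \<Rightarrow> nat list \<Rightarrow> nat list" where
  "section_at m \<alpha> y = (\<lambda>w\<in>tree_words m. tl (\<alpha> (y # w)))"

lemma tree_auts_closed: "\<alpha> \<in> tree_auts m \<Longrightarrow> w \<in> tree_words m \<Longrightarrow> \<alpha> w \<in> tree_words m"
  by (auto simp: tree_auts_def dest!: Bij_imp_funcset)

theorem group_tree_aut_group: "group (tree_aut_group m)"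
proof (rule groupI)
  show "\<one>\<^bsub>tree_aut_group m\<^esub> \<in> carrier (tree_aut_group m)"
    using id_Bij[of "tree_words m"]
    by (simp add: tree_aut_group_def tree_auts_def) (simp add: tree_words_def)
next
  fix \<alpha> \<beta> assume "\<alpha> \<in> carrier (tree_aut_group m)" "\<beta> \<in> carrier (tree_aut_group m)"
  then have ab: "\<alpha> \<in> tree_auts m" "\<beta> \<in> tree_auts m" by (simp_all add: tree_aut_group_def)
  have "[] \<in> tree_words m" by (simp add: tree_words_def)
  then have "compose (tree_words m) \<beta> \<alpha> \<in> tree_auts m"
    using ab tree_auts_closed[OF ab(1)] by (simp add: tree_auts_def compose_Bij compose_eq)
  then show "\<alpha> \<otimes>\<^bsub>tree_aut_group m\<^esub> \<beta> \<in> carrier (tree_aut_group m)"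
    by (simp add: tree_aut_group_def)
next
  fix \<alpha> \<beta> \<gamma> assume "\<alpha> \<in> carrier (tree_aut_group m)"
  then have "\<alpha> \<in> tree_words m \<rightarrow> tree_words m"
    by (auto simp: tree_aut_group_def tree_auts_closed)
  then show "\<alpha> \<otimes>\<^bsub>tree_aut_group m\<^esub> \<beta> \<otimes>\<^bsub>tree_aut_group m\<^esub> \<gamma>
           = \<alpha> \<otimes>\<^bsub>tree_aut_group m\<^esub> (\<beta> \<otimes>\<^bsub>tree_aut_group m\<^esub> \<gamma>)"
    by (simp add: tree_aut_group_def compose_assoc)
next
  fix \<alpha> assume "\<alpha> \<in> carrier (tree_aut_group m)"
  then have a: "\<alpha> \<in> Bij (tree_words m)"
    by (simp add: tree_aut_group_def tree_auts_def)
  then show "\<one>\<^bsub>tree_aut_group m\<^esub> \<otimes>\<^bsub>tree_aut_group m\<^esub> \<alpha> = \<alpha>"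
    using Bij_imp_funcset[OF a] Bij_imp_extensional[OF a]
    by (simp add: tree_aut_group_def compose_Id)
next
  fix \<alpha> assume "\<alpha> \<in> carrier (tree_aut_group m)"
  then have a: "\<alpha> \<in> tree_auts m" by (simp add: tree_aut_group_def)
  let ?T = "tree_words m"
  let ?\<beta> = "\<lambda>w\<in>?T. inv_into ?T \<alpha> w"
  have aB: "\<alpha> \<in> Bij ?T" using a by (simp add: tree_auts_def)
  then have inj: "inj_on \<alpha> ?T" and im: "\<alpha> ` ?T = ?T"
    by (auto simp: Bij_def bij_betw_def)
  have nil: "[] \<in> ?T" by (simp add: tree_words_def)
  have b: "?\<beta> w \<in> ?T" "\<alpha> (?\<beta> w) = w" if "w \<in> ?T" for w
    using that im by (auto simp: f_inv_into_f inv_into_into)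
  have "?\<beta> \<in> tree_auts m"
    unfolding tree_auts_def
  proof (intro CollectI conjI ballI)
    show "?\<beta> \<in> Bij ?T" using aB by (rule restrict_inv_into_Bij)
    show "?\<beta> [] = []"
      using inv_into_f_f[OF inj nil] a nil by (simp add: tree_auts_def)
    fix v w assume vw: "v \<in> ?T" "w \<in> ?T"
    then have "tree_adjacent (\<alpha> (?\<beta> v)) (\<alpha> (?\<beta> w)) \<longleftrightarrow> tree_adjacent (?\<beta> v) (?\<beta> w)"
      using a b(1) unfolding tree_auts_def by blast
    then show "tree_adjacent (?\<beta> v) (?\<beta> w) \<longleftrightarrow> tree_adjacent v w"
      using b(2) vw by metis
  qed
  moreover have "compose ?T \<alpha> ?\<beta> = (\<lambda>w\<in>?T. w)"
    using b by (auto simp: compose_def)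
  ultimately show "\<exists>\<beta>\<in>carrier (tree_aut_group m). \<beta> \<otimes>\<^bsub>tree_aut_group m\<^esub> \<alpha> = \<one>\<^bsub>tree_aut_group m\<^esub>"
    by (auto simp: tree_aut_group_def)
qed

lemma tree_auts_snoc:
  assumes a: "\<alpha> \<in> tree_auts m" and w: "w @ [y] \<in> tree_words m"
  shows "\<exists>z. \<alpha> (w @ [y]) = \<alpha> w @ [z]"
  using w
proof (induction w arbitrary: y rule: rev_induct)
  case Nil
  have "[] \<in> tree_words m" "[y] \<in> tree_words m" "tree_adjacent [] [y]"
    using Nil by (auto simp: tree_words_def tree_adjacent_def)
  then have "tree_adjacent (\<alpha> []) (\<alpha> [y])"
    using a unfolding tree_auts_def by blast
  then show ?case using a by (auto simp: tree_auts_def tree_adjacent_def)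
next
  case (snoc x w)
  have T: "w \<in> tree_words m" "w @ [x] \<in> tree_words m" "(w @ [x]) @ [y] \<in> tree_words m"
    using snoc.prems by (auto simp: tree_words_def)
  obtain z' where z': "\<alpha> (w @ [x]) = \<alpha> w @ [z']" using snoc.IH T by blast
  have "tree_adjacent (w @ [x]) ((w @ [x]) @ [y])" by (auto simp: tree_adjacent_def)
  then have "tree_adjacent (\<alpha> (w @ [x])) (\<alpha> ((w @ [x]) @ [y]))"
    using a T unfolding tree_auts_def by blast
  then obtain z where "\<alpha> ((w @ [x]) @ [y]) = \<alpha> (w @ [x]) @ [z] \<or>
      \<alpha> (w @ [x]) = \<alpha> ((w @ [x]) @ [y]) @ [z]"
    unfolding tree_adjacent_def by blast
  then show ?case
  proof
    assume "\<alpha> (w @ [x]) = \<alpha> ((w @ [x]) @ [y]) @ [z]"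
    then have "\<alpha> ((w @ [x]) @ [y]) = \<alpha> w" using z' by simp
    moreover have "inj_on \<alpha> (tree_words m)"
      using a by (simp add: tree_auts_def Bij_def bij_betw_def)
    ultimately have "(w @ [x]) @ [y] = w" using T by (meson inj_onD)
    then show ?thesis by simp
  qed blast
qed

text \<open>The wreath decomposition: \<open>\<alpha>\<close> sends \<open>y w\<close> to the image of \<open>y\<close> under the first-level
  action followed by the image of \<open>w\<close> under the section of \<open>\<alpha>\<close> at \<open>y\<close>.\<close>

lemma tree_auts_Cons:
  assumes a: "\<alpha> \<in> tree_auts m" and w: "y # w \<in> tree_words m"
  shows "\<alpha> (y # w) = first_level \<alpha> y # section_at m \<alpha> y w"
proof -
  have "\<exists>w'. \<alpha> (y # w) = first_level \<alpha> y # w'"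
    using w
  proof (induction w rule: rev_induct)
    case Nil
    then obtain z where "\<alpha> ([] @ [y]) = \<alpha> [] @ [z]" using tree_auts_snoc[OF a, of "[]" y] by auto
    then show ?case using a by (auto simp: first_level_def tree_auts_def)
  next
    case (snoc x w)
    have "y # w \<in> tree_words m" using snoc.prems by (auto simp: tree_words_def)
    then obtain w' where "\<alpha> (y # w) = first_level \<alpha> y # w'" using snoc.IH by blast
    moreover obtain z where "\<alpha> ((y # w) @ [x]) = \<alpha> (y # w) @ [z]"
      using tree_auts_snoc[OF a, of "y # w" x] snoc.prems by auto
    ultimately show ?case by simp
  qed
  then show ?thesis using w by (auto simp: section_at_def tree_words_def)
qed

inductive_set states :: "nat \<Rightarrow> (nat list \<Rightarrow> nat list) \<Rightarrow> (nat list \<Rightarrow> nat list) set"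
  for m :: nat and \<alpha> :: "nat list \<Rightarrow> nat list" where
  states_self: "\<alpha> \<in> states m \<alpha>"
| states_section: "\<beta> \<in> states m \<alpha> \<Longrightarrow> y < m \<Longrightarrow> section_at m \<beta> y \<in> states m \<alpha>"

definition state_closed :: "nat \<Rightarrow> (nat list \<Rightarrow> nat list) set \<Rightarrow> bool" where
  "state_closed m H \<longleftrightarrow>
     subgroup H (tree_aut_group m) \<and> (\<forall>\<alpha>\<in>H. states m \<alpha> \<subseteq> H)"

end

theory Submission
  imports Defs
begin

text \<open>
  A faithful state-closed representation \<open>\<phi>\<close> gives, for every letter \<open>y\<close>, a homomorphism
  \<open>f\<close> from the stabiliser \<open>H\<close> of \<open>y\<close> to $N_{3,4}$, sending \<open>g\<close> to the preimage of the state of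
  \<open>\<phi> g\<close> at \<open>y\<close>.  A nontrivial set \<open>K\<close> that lies in all these stabilisers and is mapped into itself by
  all these homomorphisms contradicts faithfulness, since its elements fix every word.  With \<open>n = m!\<close>
  the set \<open>K = {1, [a^n, c^n, a^n]}\<close> has this property, because every homomorphism from a subgroup
  containing the \<open>n\<close>-th powers of the generators either kills \<open>[a^n, c^n, a^n]\<close> or fixes it.

  To see this let $A$ be the matrix induced on the abelianisation $\mathbb{Z}^4 = P \oplus Q$,
  $P = \langle a, b\rangle$, $Q = \langle c, d\rangle$.  The commutators \<open>[a, b]\<close> and \<open>[c, d]\<close>
  lie in the third term of the lower central series, so the images of $a \wedge b$ and $c \wedge d$
  under $A$ are bivectors in $\Lambda^2 P \oplus \Lambda^2 Q$; being decomposable they are zero or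
  span $\Lambda^2 P$ or $\Lambda^2 Q$.  If one of them vanishes, or both $P$ and $Q$ go to the same
  summand, the cubic relators make the image of \<open>[a, c, a]\<close> trivial.  An exchange of $P$ and
  $Q$ contradicts the cubic relators, and if $A$ preserves $P$ and $Q$ they force $A$ to be a scalar
  $l$.  The inhomogeneous relator \<open>[a, b] = [a, c, c]\<close> finally gives $n l^2 = l^3$, so $l = n$.
\<close>

section \<open>Commutators in groups of class three\<close>

context group
begin

lemma subgroup_nat_pow_closed:
  "subgroup H G \<Longrightarrow> x \<in> H \<Longrightarrow> x [^] (n :: nat) \<in> H"
  by (induction n) (simp_all add: subgroup.one_closed subgroup.m_closed)

lemma inv_cancel:
  assumes "x \<in> carrier G" "z \<in> carrier G"
  shows "inv x \<otimes> (x \<otimes> z) = z" "x \<otimes> (inv x \<otimes> z) = z"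
  using assms by (simp_all flip: m_assoc)

lemma commutator_mult_left:
  assumes "x \<in> carrier G" "y \<in> carrier G" "z \<in> carrier G"
  shows "commutator G (x \<otimes> y) z = inv y \<otimes> commutator G x z \<otimes> y \<otimes> commutator G y z"
  using assms by (simp add: commutator_def inv_mult_group m_assoc inv_cancel)

lemma commutator_mult_right:
  assumes "x \<in> carrier G" "y \<in> carrier G" "z \<in> carrier G"
  shows "commutator G x (y \<otimes> z) = commutator G x z \<otimes> (inv z \<otimes> commutator G x y \<otimes> z)"
  using assms by (simp add: commutator_def inv_mult_group m_assoc inv_cancel)

lemma conj_eq_commutator:
  assumes "x \<in> carrier G" "y \<in> carrier G"
  shows "inv y \<otimes> x \<otimes> y = x \<otimes> commutator G x y"
  using assms by (simp add: commutator_def m_assoc inv_cancel)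

lemma commutator_swap:
  assumes "x \<in> carrier G" "y \<in> carrier G"
  shows "commutator G y x = inv (commutator G x y)"
  using assms by (simp add: commutator_def inv_mult_group m_assoc)

lemma mult_commutator:
  assumes "x \<in> carrier G" "y \<in> carrier G"
  shows "y \<otimes> x \<otimes> commutator G x y = x \<otimes> y"
  using assms by (simp add: commutator_def inv_mult_group m_assoc inv_cancel)

lemma commutator_eq_one_iff:
  assumes "x \<in> carrier G" "y \<in> carrier G"
  shows "commutator G x y = \<one> \<longleftrightarrow> x \<otimes> y = y \<otimes> x"
  using mult_commutator[OF assms] assms
  by (metis commutator_closed l_cancel_one m_closed)

lemma commutator3_closed [simp]:
  "x \<in> carrier G \<Longrightarrow> y \<in> carrier G \<Longrightarrow> z \<in> carrier G \<Longrightarrow> commutator3 G x y z \<in> carrier G"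
  by (simp add: commutator3_def)

lemma commutator_one [simp]:
  "x \<in> carrier G \<Longrightarrow> commutator G x \<one> = \<one>" "x \<in> carrier G \<Longrightarrow> commutator G \<one> x = \<one>"
  by (simp_all add: commutator_def)

lemma commutator_self [simp]: "x \<in> carrier G \<Longrightarrow> commutator G x x = \<one>"
  by (simp add: commutator_eq_one_iff)

section \<open>The lower central series\<close>

lemma subgroup_lower_central: "subgroup (lower_central G n) G"
  by (rule normal_imp_subgroup[OF normal_lower_central])

lemma lower_central_closed: "u \<in> lower_central G n \<Longrightarrow> u \<in> carrier G"
  using subgroup.mem_carrier[OF subgroup_lower_central] .

lemma commutator_lower_central:
  "u \<in> lower_central G n \<Longrightarrow> g \<in> carrier G \<Longrightarrow> commutator G u g \<in> lower_central G (Suc n)"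
  by (auto intro: generate.incl)

lemma lower_central_Suc_subsetI:
  assumes "subgroup S G" "\<And>u g. u \<in> lower_central G n \<Longrightarrow> g \<in> carrier G \<Longrightarrow> commutator G u g \<in> S"
  shows "lower_central G (Suc n) \<subseteq> S"
proof -
  have "{commutator G x y |x y. x \<in> lower_central G n \<and> y \<in> carrier G} \<subseteq> S"
    using assms(2) by auto
  from generate_subgroup_incl[OF this assms(1)] show ?thesis by simp
qed

lemma lower_central_Suc_subset: "lower_central G (Suc n) \<subseteq> lower_central G n"
proof -
  interpret L: normal "lower_central G n" G by (rule normal_lower_central)
  have "commutator G u g \<in> lower_central G n" if "u \<in> lower_central G n" "g \<in> carrier G" for u g
  proof -
    have "inv g \<otimes> u \<otimes> g \<in> lower_central G n" using L.inv_op_closed1 that by blast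
    then have "inv u \<otimes> (inv g \<otimes> u \<otimes> g) \<in> lower_central G n" using that by blast
    then show ?thesis using that by (simp add: commutator_def m_assoc)
  qed
  then show ?thesis by (rule lower_central_Suc_subsetI[OF L.subgroup_axioms])
qed

lemma commutator_restrict:
  assumes "subgroup H G" "x \<in> H" "y \<in> H"
  shows "commutator (G\<lparr>carrier := H\<rparr>) x y = commutator G x y"
  using assms by (simp add: commutator_def)

end

text \<open>Since \<open>lower_central\<close> is indexed from 0, the assumption says nilpotency
  class at most three: \<open>lower_central G 1\<close> is the derived subgroup and
  \<open>lower_central G 2\<close> the last term that can be nontrivial.\<close>

locale class3_group = group +
  assumes lower_central_3: "lower_central G 3 = {\<one>}"
begin

section \<open>Commutator calculus in class three\<close>

lemma lower_central_2_central:
  assumes "u \<in> lower_central G 2" "g \<in> carrier G"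
  shows "u \<otimes> g = g \<otimes> u"
proof -
  have "commutator G u g \<in> lower_central G (Suc 2)" using assms commutator_lower_central by blast
  then have "commutator G u g = \<one>" using lower_central_3 by (simp add: numeral_3_eq_3 numeral_2_eq_2)
  then show ?thesis using commutator_eq_one_iff assms lower_central_closed by blast
qed

lemma commutator_in_1: "x \<in> carrier G \<Longrightarrow> y \<in> carrier G \<Longrightarrow> commutator G x y \<in> lower_central G 1"
  using commutator_lower_central[of x 0 y] by simp

lemma commutator_in_2: "u \<in> lower_central G 1 \<Longrightarrow> y \<in> carrier G \<Longrightarrow> commutator G u y \<in> lower_central G 2"
  using commutator_lower_central[of u 1 y] by (simp add: numeral_2_eq_2)

lemma commutator3_in_2:
  "x \<in> carrier G \<Longrightarrow> y \<in> carrier G \<Longrightarrow> z \<in> carrier G \<Longrightarrow> commutator3 G x y z \<in> lower_central G 2"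
  by (simp add: commutator3_def commutator_in_1 commutator_in_2 del: One_nat_def)

lemma conj_lower_central_2:
  assumes "u \<in> lower_central G 2" "g \<in> carrier G"
  shows "inv g \<otimes> u \<otimes> g = u"
  using assms lower_central_2_central lower_central_closed
  by (metis inv_cancel(1) inv_closed m_assoc)

lemma commutator_derived_mult_right:
  assumes "u \<in> lower_central G 1" "x \<in> carrier G" "y \<in> carrier G"
  shows "commutator G u (x \<otimes> y) = commutator G u x \<otimes> commutator G u y"
  using assms lower_central_closed[OF assms(1)]
  by (simp add: commutator_mult_right conj_lower_central_2 commutator_in_2 lower_central_2_central
      del: One_nat_def)

lemma commutator_derived_inv_right:
  assumes "u \<in> lower_central G 1" "x \<in> carrier G"
  shows "commutator G u (inv x) = inv (commutator G u x)"
  using commutator_derived_mult_right[OF assms(1), of "inv x" x] assms lower_central_closed[OF assms(1)]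
  by (metis commutator_closed commutator_one(1) inv_closed inv_equality l_inv)

lemma commutator_derived_mult_left:
  assumes "u \<in> lower_central G 1" "v \<in> lower_central G 1" "x \<in> carrier G"
  shows "commutator G (u \<otimes> v) x = commutator G u x \<otimes> commutator G v x"
  using assms lower_central_closed[OF assms(1)] lower_central_closed[OF assms(2)]
  by (simp add: commutator_mult_left conj_lower_central_2 commutator_in_2
      del: One_nat_def)

lemma commutator_derived_inv_left:
  assumes "u \<in> lower_central G 1" "x \<in> carrier G"
  shows "commutator G (inv u) x = inv (commutator G u x)"
proof -
  have "inv u \<in> lower_central G 1"
    using subgroup.m_inv_closed[OF subgroup_lower_central] assms by blast
  from commutator_derived_mult_left[OF this assms] show ?thesis
    using assms lower_central_closed[OF assms(1)]
    by (metis commutator_closed commutator_one(2) inv_closed inv_equality l_inv)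
qed

text \<open>For \<open>u\<close> in the derived subgroup, \<open>g\<close> going to
  \<open>[u, g]\<close> is a homomorphism into the centre, so it kills all commutators; its kernel
  \<open>?C\<close> therefore contains the derived subgroup.\<close>

lemma derived_abelian:
  assumes "u \<in> lower_central G 1" "v \<in> lower_central G 1"
  shows "u \<otimes> v = v \<otimes> u"
proof -
  have u: "u \<in> carrier G" using assms(1) lower_central_closed by blast
  let ?C = "{v \<in> carrier G. commutator G u v = \<one>}"
  have "subgroup ?C G"
    using assms(1) u by (intro subgroupI)
      (auto simp: commutator_derived_mult_right commutator_derived_inv_right intro: exI[of _ \<one>]
        simp del: One_nat_def)
  moreover have "commutator G x y \<in> ?C" if xy: "x \<in> carrier G" "y \<in> carrier G" for x y
  proof -
    have c: "commutator G u g \<otimes> h = h \<otimes> commutator G u g" if "g \<in> carrier G" "h \<in> carrier G" for g h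
      using lower_central_2_central commutator_in_2 assms(1) that by blast
    have "commutator G u (x \<otimes> y) = commutator G u (y \<otimes> x)"
      using assms(1) xy c[of x "commutator G u y"] u
      by (simp add: commutator_derived_mult_right del: One_nat_def)
    \<comment> \<open>The same value computed from \<open>x y = y x [x, y]\<close>; comparison with
      the line before gives \<open>[u, [x, y]] = 1\<close>.\<close>
    moreover have "commutator G u (x \<otimes> y)
        = commutator G u (y \<otimes> x) \<otimes> commutator G u (commutator G x y)"
      using commutator_derived_mult_right[OF assms(1), of "y \<otimes> x" "commutator G x y"] xy
      by (simp add: mult_commutator)
    ultimately have "commutator G u (commutator G x y) = \<one>"
      using u xy by (metis commutator_closed l_cancel_one' m_closed)
    then show ?thesis using xy by simp
  qed
  ultimately have "lower_central G (Suc 0) \<subseteq> ?C"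
    by (intro lower_central_Suc_subsetI) simp_all
  then have "commutator G u v = \<one>" using assms(2) by auto
  then show ?thesis using commutator_eq_one_iff u assms(2) lower_central_closed by blast
qed

text \<open>Expanding the inner commutator of a product produces a conjugate. In class three
  conjugation changes an element of the derived subgroup only by a central factor, which the outer
  commutator does not see. The last slot is \<open>commutator_derived_mult_right\<close>.\<close>

lemma commutator3_mult:
  assumes "x \<in> carrier G" "x' \<in> carrier G" "y \<in> carrier G" "z \<in> carrier G"
  shows "commutator3 G (x \<otimes> x') y z = commutator3 G x y z \<otimes> commutator3 G x' y z"
    and "commutator3 G y (x \<otimes> x') z = commutator3 G y x z \<otimes> commutator3 G y x' z"
    and "commutator3 G y z (x \<otimes> x') = commutator3 G y z x \<otimes> commutator3 G y z x'"
proof -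
  have conj: "inv g \<otimes> u \<otimes> g \<in> lower_central G 1"
      "commutator G (inv g \<otimes> u \<otimes> g) z = commutator G u z"
    if u: "u \<in> lower_central G 1" and g: "g \<in> carrier G" for u g
  proof -
    have 2: "commutator G u g \<in> lower_central G 2" using commutator_in_2 u g by blast
    then have 1: "commutator G u g \<in> lower_central G 1"
      using lower_central_Suc_subset[of 1] by (auto simp: numeral_2_eq_2)
    have eq: "inv g \<otimes> u \<otimes> g = u \<otimes> commutator G u g"
      using conj_eq_commutator u g lower_central_closed by blast
    then show "inv g \<otimes> u \<otimes> g \<in> lower_central G 1"
      using u 1 subgroup.m_closed[OF subgroup_lower_central] by metis
    have "commutator G (commutator G u g) z = \<one>"
      using 2 lower_central_2_central lower_central_closed commutator_eq_one_iff assms by blast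
    then show "commutator G (inv g \<otimes> u \<otimes> g) z = commutator G u z"
      using eq commutator_derived_mult_left[OF u 1] assms u lower_central_closed
      by (metis commutator_closed r_one)
  qed
  show "commutator3 G (x \<otimes> x') y z = commutator3 G x y z \<otimes> commutator3 G x' y z"
    using assms conj(1)[OF commutator_in_1, of x y x'] conj(2)[OF commutator_in_1, of x y x']
      commutator_derived_mult_left[of "inv x' \<otimes> commutator G x y \<otimes> x'" "commutator G x' y" z]
    by (simp add: commutator3_def commutator_mult_left[of x] commutator_in_1 del: One_nat_def)
  show "commutator3 G y (x \<otimes> x') z = commutator3 G y x z \<otimes> commutator3 G y x' z"
    using assms conj(1)[OF commutator_in_1, of y x x'] conj(2)[OF commutator_in_1, of y x x']
      commutator_derived_mult_left[of "commutator G y x'" "inv x' \<otimes> commutator G y x \<otimes> x'" z]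
      lower_central_2_central[OF commutator3_in_2[of y x z], of "commutator3 G y x' z"]
    by (simp add: commutator3_def commutator_mult_right commutator_in_1 del: One_nat_def)
  show "commutator3 G y z (x \<otimes> x') = commutator3 G y z x \<otimes> commutator3 G y z x'"
    using assms by (simp add: commutator3_def commutator_derived_mult_right
        commutator_in_1 del: One_nat_def)
qed

lemma commutator3_one:
  assumes "y \<in> carrier G" "z \<in> carrier G"
  shows "commutator3 G \<one> y z = \<one>" "commutator3 G y \<one> z = \<one>" "commutator3 G y z \<one> = \<one>"
  using assms by (simp_all add: commutator3_def)

lemma commutator3_inv:
  assumes "x \<in> carrier G" "y \<in> carrier G" "z \<in> carrier G"
  shows "commutator3 G (inv x) y z = inv (commutator3 G x y z)"
    and "commutator3 G y (inv x) z = inv (commutator3 G y x z)"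
    and "commutator3 G y z (inv x) = inv (commutator3 G y z x)"
  using assms commutator3_mult[of "inv x" x y z] commutator3_one
  by (metis commutator3_closed inv_closed inv_equality l_inv)+

lemma subgroup_commutator3_mem:
  assumes "subgroup S G" "y \<in> carrier G" "z \<in> carrier G"
  shows "subgroup {x \<in> carrier G. commutator3 G x y z \<in> S} G"
    and "subgroup {x \<in> carrier G. commutator3 G y x z \<in> S} G"
    and "subgroup {x \<in> carrier G. commutator3 G y z x \<in> S} G"
proof -
  interpret S: subgroup S G by (rule assms)
  have *: "subgroup {x \<in> carrier G. h x \<in> S} G"
    if "h \<one> = \<one>" "\<And>x. x \<in> carrier G \<Longrightarrow> h (inv x) = inv (h x)"
      "\<And>x y. x \<in> carrier G \<Longrightarrow> y \<in> carrier G \<Longrightarrow> h (x \<otimes> y) = h x \<otimes> h y" for h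
  proof (rule subgroupI)
    show "{x \<in> carrier G. h x \<in> S} \<noteq> {}" using that(1) by force
  qed (auto simp: that)
  show "subgroup {x \<in> carrier G. commutator3 G x y z \<in> S} G"
    by (rule *[of "\<lambda>x. commutator3 G x y z"])
      (simp_all only: assms commutator3_mult commutator3_inv commutator3_one)
  show "subgroup {x \<in> carrier G. commutator3 G y x z \<in> S} G"
    by (rule *[of "\<lambda>x. commutator3 G y x z"])
      (simp_all only: assms commutator3_mult commutator3_inv commutator3_one)
  show "subgroup {x \<in> carrier G. commutator3 G y z x \<in> S} G"
    by (rule *[of "\<lambda>x. commutator3 G y z x"])
      (simp_all only: assms commutator3_mult commutator3_inv commutator3_one)
qed

text \<open>Multiplicativity in each slot reduces the test to generators: the slots are extended
  from \<open>X\<close> to the whole group one by one, the last slot first, and finally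
  \<open>[x, y]\<close> is replaced by any element of the derived subgroup.\<close>

lemma lower_central_2_subset:
  assumes X: "X \<subseteq> carrier G" "generate G X = carrier G" and S: "subgroup S G"
    and T: "\<And>x y z. x \<in> X \<Longrightarrow> y \<in> X \<Longrightarrow> z \<in> X \<Longrightarrow> commutator3 G x y z \<in> S"
  shows "lower_central G 2 \<subseteq> S"
proof -
  note sub = subgroup_commutator3_mem[OF S]
  have 1: "commutator3 G x y z \<in> S" if "x \<in> X" "y \<in> X" "z \<in> carrier G" for x y z
  proof -
    have "X \<subseteq> {z \<in> carrier G. commutator3 G x y z \<in> S}" using that X T by blast
    then have "generate G X \<subseteq> {z \<in> carrier G. commutator3 G x y z \<in> S}"
      using that X by (intro generate_subgroup_incl sub) auto
    then show ?thesis using X that by blast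
  qed
  have 2: "commutator3 G x y z \<in> S" if "x \<in> X" "y \<in> carrier G" "z \<in> carrier G" for x y z
  proof -
    have "X \<subseteq> {y \<in> carrier G. commutator3 G x y z \<in> S}" using that X 1 by blast
    then have "generate G X \<subseteq> {y \<in> carrier G. commutator3 G x y z \<in> S}"
      using that X by (intro generate_subgroup_incl sub) auto
    then show ?thesis using X that by blast
  qed
  have 3: "commutator3 G x y z \<in> S" if "x \<in> carrier G" "y \<in> carrier G" "z \<in> carrier G" for x y z
  proof -
    have "X \<subseteq> {x \<in> carrier G. commutator3 G x y z \<in> S}" using that X 2 by blast
    then have "generate G X \<subseteq> {x \<in> carrier G. commutator3 G x y z \<in> S}"
      using that X by (intro generate_subgroup_incl sub) auto
    then show ?thesis using X that by blast
  qed
  have 4: "commutator G u z \<in> S" if u: "u \<in> lower_central G 1" and z: "z \<in> carrier G" for u z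
  proof -
    interpret S: subgroup S G by (rule S)
    let ?U = "{u \<in> lower_central G 1. commutator G u z \<in> S}"
    have "subgroup ?U G"
      using z subgroup.m_closed[OF subgroup_lower_central]
        subgroup.m_inv_closed[OF subgroup_lower_central]
        subgroup.one_closed[OF subgroup_lower_central, of 1] lower_central_closed
      by (intro subgroupI) (auto simp: commutator_derived_mult_left commutator_derived_inv_left
          simp del: One_nat_def intro: exI[of _ \<one>])
    moreover have "commutator G x y \<in> ?U" if "x \<in> carrier G" "y \<in> carrier G" for x y
      using 3 z that commutator_in_1 by (simp add: commutator3_def del: One_nat_def)
    ultimately have "lower_central G (Suc 0) \<subseteq> ?U"
      by (intro lower_central_Suc_subsetI) simp_all
    then show ?thesis using u by auto
  qed
  then have "lower_central G (Suc 1) \<subseteq> S"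
    by (intro lower_central_Suc_subsetI[OF S])
  then show ?thesis by (simp add: numeral_2_eq_2)
qed

text \<open>A substitute for the Hall-Witt identity. As \<open>[y, z]\<close> is central,
  \<open>y z\<close> and \<open>z y\<close> have the same commutator with \<open>x\<close>;
  expanding both and cancelling \<open>[x, y] [x, z]\<close> leaves the claim.\<close>

lemma commutator3_comm:
  assumes x: "x \<in> carrier G" "y \<in> carrier G" "z \<in> carrier G"
    and yz: "commutator G y z \<in> lower_central G 2"
  shows "commutator3 G x y z = commutator3 G x z y"
proof -
  let ?w = "commutator G y z"
  have xw: "commutator G x ?w = \<one>"
    using lower_central_2_central[OF yz x(1)] x by (simp add: commutator_eq_one_iff)
  have "commutator G x (z \<otimes> y \<otimes> ?w) = commutator G x ?w \<otimes> (inv ?w \<otimes> commutator G x (z \<otimes> y) \<otimes> ?w)"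
    using x by (simp add: commutator_mult_right)
  also have "inv ?w \<otimes> commutator G x (z \<otimes> y) \<otimes> ?w = commutator G x (z \<otimes> y)"
    using x lower_central_2_central[OF yz, of "commutator G x (z \<otimes> y)"]
    by (metis commutator_closed inv_cancel(1) m_assoc m_closed inv_closed)
  finally have eq: "commutator G x (y \<otimes> z) = commutator G x (z \<otimes> y)"
    using x xw by (simp add: mult_commutator)
  have exp: "commutator G x (y \<otimes> z) = commutator G x y \<otimes> commutator G x z \<otimes> commutator3 G x y z"
    if "y \<in> carrier G" "z \<in> carrier G" for y z
    using x(1) that derived_abelian[OF commutator_in_1 commutator_in_1, of x y x z]
    by (simp add: commutator_mult_right conj_eq_commutator commutator3_def flip: m_assoc)
  have "commutator G x z \<otimes> commutator G x y = commutator G x y \<otimes> commutator G x z"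
    using x derived_abelian[OF commutator_in_1 commutator_in_1] by blast
  then show ?thesis
    using eq exp[OF x(2,3)] exp[OF x(3,2)] x
    by (metis commutator3_closed commutator_closed m_assoc m_closed Units_eq Units_l_cancel)
qed

lemma commutator_nat_pow_in_2:
  assumes "x \<in> carrier G" "y \<in> carrier G" "commutator G x y \<in> lower_central G 2"
  shows "commutator G (x [^] (m :: nat)) (y [^] (n :: nat)) \<in> lower_central G 2"
proof -
  interpret L: subgroup "lower_central G 2" G by (rule subgroup_lower_central)
  have pow: "commutator G (x [^] (m :: nat)) y \<in> lower_central G 2"
    if "x \<in> carrier G" "y \<in> carrier G" "commutator G x y \<in> lower_central G 2" for x y m
    using that by (induction m) (simp_all add: commutator_mult_left conj_lower_central_2)
  have swap: "commutator G y x \<in> lower_central G 2"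
    if "x \<in> carrier G" "y \<in> carrier G" "commutator G x y \<in> lower_central G 2" for x y
    using that commutator_swap[of x y] by simp
  have xm: "x [^] m \<in> carrier G" and yn: "y [^] n \<in> carrier G" using assms by auto
  have "commutator G y (x [^] m) \<in> lower_central G 2"
    using swap[OF xm assms(2) pow[OF assms]] .
  from swap[OF yn xm pow[OF assms(2) xm this]] show ?thesis .
qed

end

section \<open>Stabilisers and states\<close>

lemma tree_words_Cons [simp]: "y # w \<in> tree_words m \<longleftrightarrow> y < m \<and> w \<in> tree_words m"
  by (auto simp: tree_words_def)

lemma tree_words_Nil [simp]: "[] \<in> tree_words m"
  by (simp add: tree_words_def)

lemma tree_aut_mult:
  "w \<in> tree_words m \<Longrightarrow> (\<alpha> \<otimes>\<^bsub>tree_aut_group m\<^esub> \<beta>) w = \<beta> (\<alpha> w)"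
  by (simp add: tree_aut_group_def compose_eq)

lemma tree_aut_carrier [simp]: "carrier (tree_aut_group m) = tree_auts m"
  by (simp add: tree_aut_group_def)

lemma first_level_less:
  assumes "\<alpha> \<in> tree_auts m" "y < m"
  shows "first_level \<alpha> y < m"
  using tree_auts_closed[OF assms(1), of "[y]"] tree_auts_Cons[OF assms(1), of y "[]"] assms(2)
  by simp

lemma section_at_word:
  assumes "\<alpha> \<in> tree_auts m" "y < m" "w \<in> tree_words m"
  shows "section_at m \<alpha> y w \<in> tree_words m"
  using tree_auts_closed[OF assms(1), of "y # w"] tree_auts_Cons[OF assms(1), of y w] assms(2,3)
  by simp

lemma first_level_mult:
  assumes "\<alpha> \<in> tree_auts m" "\<beta> \<in> tree_auts m" "y < m"
  shows "first_level (\<alpha> \<otimes>\<^bsub>tree_aut_group m\<^esub> \<beta>) y = first_level \<beta> (first_level \<alpha> y)"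
proof -
  have "section_at m \<alpha> y [] \<in> tree_words m" using section_at_word[OF assms(1,3)] by simp
  then show ?thesis
    using assms tree_auts_Cons[OF assms(1), of y "[]"] first_level_less[OF assms(1,3)]
      tree_auts_Cons[OF assms(2), of "first_level \<alpha> y" "section_at m \<alpha> y []"]
    by (simp add: first_level_def[of "\<alpha> \<otimes>\<^bsub>tree_aut_group m\<^esub> \<beta>"] tree_aut_mult)
qed

lemma section_at_mult:
  assumes "\<alpha> \<in> tree_auts m" "\<beta> \<in> tree_auts m" "y < m"
  shows "section_at m (\<alpha> \<otimes>\<^bsub>tree_aut_group m\<^esub> \<beta>) y
    = section_at m \<alpha> y \<otimes>\<^bsub>tree_aut_group m\<^esub> section_at m \<beta> (first_level \<alpha> y)"
proof
  fix w
  show "section_at m (\<alpha> \<otimes>\<^bsub>tree_aut_group m\<^esub> \<beta>) y w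
    = (section_at m \<alpha> y \<otimes>\<^bsub>tree_aut_group m\<^esub> section_at m \<beta> (first_level \<alpha> y)) w"
  proof (cases "w \<in> tree_words m")
    case True
    then show ?thesis
      using assms section_at_word[OF assms(1,3) True] first_level_less[OF assms(1,3)]
        tree_auts_Cons[OF assms(1), of y w]
        tree_auts_Cons[OF assms(2), of "first_level \<alpha> y" "section_at m \<alpha> y w"]
      by (simp add: section_at_def[of m "\<alpha> \<otimes>\<^bsub>tree_aut_group m\<^esub> \<beta>"] tree_aut_mult)
  next
    case False
    then show ?thesis by (simp add: section_at_def tree_aut_group_def compose_def)
  qed
qed

lemma first_level_one: "y < m \<Longrightarrow> first_level \<one>\<^bsub>tree_aut_group m\<^esub> y = y"
  by (simp add: first_level_def tree_aut_group_def)

section \<open>Letter stabilisers and the homomorphisms defined on them\<close>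

lemma (in group) subgroup_level_stabilizer:
  assumes \<phi>: "\<phi> \<in> hom G (tree_aut_group m)" and y: "y < m"
  shows "subgroup {g \<in> carrier G. first_level (\<phi> g) y = y} G"
proof -
  interpret \<phi>: group_hom G "tree_aut_group m" \<phi>
    using \<phi> by (intro group_hom.intro group_hom_axioms.intro is_group group_tree_aut_group)
  have aut: "\<phi> g \<in> tree_auts m" if "g \<in> carrier G" for g using \<phi>.hom_closed[OF that] by simp
  have mult: "first_level (\<phi> (g \<otimes> h)) y = first_level (\<phi> h) (first_level (\<phi> g) y)"
    if "g \<in> carrier G" "h \<in> carrier G" for g h
    using that aut y by (simp add: first_level_mult)
  have one: "first_level (\<phi> \<one>) y = y" using y by (simp add: first_level_one)
  show ?thesis
  proof (rule subgroupI)
    show "{g \<in> carrier G. first_level (\<phi> g) y = y} \<noteq> {}" using one by blast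
  next
    fix g assume "g \<in> {g \<in> carrier G. first_level (\<phi> g) y = y}"
    then show "inv g \<in> {g \<in> carrier G. first_level (\<phi> g) y = y}"
      using mult[of g "inv g"] one by (simp del: \<phi>.hom_inv)
  next
    fix g h assume "g \<in> {g \<in> carrier G. first_level (\<phi> g) y = y}"
      "h \<in> {g \<in> carrier G. first_level (\<phi> g) y = y}"
    then show "g \<otimes> h \<in> {g \<in> carrier G. first_level (\<phi> g) y = y}"
      using mult[of g h] by simp
  qed blast
qed

text \<open>The orbit of \<open>y\<close> under \<open>g\<close> lies among \<open>m\<close>
  letters, so some exponent between 1 and \<open>m\<close> returns \<open>y\<close> to itself, and
  every such exponent divides \<open>fact m\<close>.\<close>

lemma (in group) pow_fact_level_stabilizer:
  assumes \<phi>: "\<phi> \<in> hom G (tree_aut_group m)" and y: "y < m" and g: "g \<in> carrier G"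
  shows "first_level (\<phi> (g [^] (fact m :: nat))) y = y"
proof -
  interpret \<phi>: group_hom G "tree_aut_group m" \<phi>
    using \<phi> by (intro group_hom.intro group_hom_axioms.intro is_group group_tree_aut_group)
  have aut: "\<phi> g \<in> tree_auts m" if "g \<in> carrier G" for g using \<phi>.hom_closed[OF that] by simp
  have mult: "first_level (\<phi> (u \<otimes> v)) z = first_level (\<phi> v) (first_level (\<phi> u) z)"
    if "u \<in> carrier G" "v \<in> carrier G" "z < m" for u v z
    using that first_level_mult[OF aut aut] by simp
  let ?S = "{g \<in> carrier G. first_level (\<phi> g) y = y}"
  define s where "s k = first_level (\<phi> (g [^] k)) y" for k :: nat
  have s: "s k < m" for k unfolding s_def using first_level_less[OF aut y] g by blast
  \<comment> \<open>Pigeonhole: \<open>m + 1\<close> indices, \<open>m\<close> letters.\<close>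
  have "\<not> inj_on s {..m}"
  proof
    assume "inj_on s {..m}"
    then have "card {..m} \<le> card {..<m}"
      using s by (intro card_inj_on_le[of s]) auto
    then show False by simp
  qed
  then obtain i j where ij: "i < j" "j \<le> m" "s i = s j"
    unfolding inj_on_def by (metis atMost_iff linorder_neqE_nat)
  let ?k = "j - i"
  have "g [^] ?k \<otimes> g [^] i = g [^] j" using g ij(1) by (simp add: nat_pow_mult)
  then have sj: "s j = first_level (\<phi> (g [^] i)) (s ?k)"
    using mult[OF nat_pow_closed[OF g] nat_pow_closed[OF g] y, of ?k i] by (simp only: s_def)
  have undo: "first_level (\<phi> (inv (g [^] i))) (first_level (\<phi> (g [^] i)) z) = z" if "z < m" for z
    using mult[OF nat_pow_closed[OF g] inv_closed[OF nat_pow_closed[OF g]] that, of i i] g that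
    by (simp only: r_inv nat_pow_closed \<phi>.hom_one first_level_one)
  \<comment> \<open>Undoing the first \<open>i\<close> steps of the orbit turns
    \<open>s i = s j\<close> into a return to \<open>y\<close> after \<open>j - i\<close>
    steps.\<close>
  have "first_level (\<phi> (g [^] i)) (s ?k) = first_level (\<phi> (g [^] i)) y"
    using sj ij(3) s_def[of i] by metis
  then have "s ?k = y" using undo[OF s[of ?k]] undo[OF y] by metis
  then have "g [^] ?k \<in> ?S" using g by (simp add: s_def)
  moreover have "?k dvd fact m" using ij by (intro dvd_fact) auto
  then obtain q where "fact m = ?k * q" by blast
  then have "g [^] (fact m :: nat) = (g [^] ?k) [^] q" using g by (simp add: nat_pow_pow)
  ultimately have "g [^] (fact m :: nat) \<in> ?S"
    using subgroup_nat_pow_closed[OF subgroup_level_stabilizer[OF \<phi> y]] by simp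
  then show ?thesis by simp
qed

text \<open>State-closedness provides a preimage of the state and injectivity makes it unique. In
  the state of a product the second factor is read at the letter to which the first one moves
  \<open>y\<close>, so \<open>f\<close> is multiplicative on \<open>H\<close>, where
  \<open>y\<close> stays in place.\<close>

lemma (in group) section_virtual_endomorphism:
  assumes \<phi>: "\<phi> \<in> hom G (tree_aut_group m)" and inj: "inj_on \<phi> (carrier G)"
    and closed: "state_closed m (\<phi> ` carrier G)" and y: "y < m"
  defines "H \<equiv> {g \<in> carrier G. first_level (\<phi> g) y = y}"
  obtains f where "f \<in> hom (G\<lparr>carrier := H\<rparr>) G"
    "\<And>g. g \<in> carrier G \<Longrightarrow> \<phi> (f g) = section_at m (\<phi> g) y"
proof -
  interpret \<phi>: group_hom G "tree_aut_group m" \<phi>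
    using \<phi> by (intro group_hom.intro group_hom_axioms.intro is_group group_tree_aut_group)
  have aut: "\<phi> g \<in> tree_auts m" if "g \<in> carrier G" for g using \<phi>.hom_closed[OF that] by simp
  define f where "f g = inv_into (carrier G) \<phi> (section_at m (\<phi> g) y)" for g
  have "section_at m (\<phi> g) y \<in> \<phi> ` carrier G" if "g \<in> carrier G" for g
    using closed that y states_section[OF states_self] by (fastforce simp: state_closed_def)
  then have f: "f g \<in> carrier G" "\<phi> (f g) = section_at m (\<phi> g) y" if "g \<in> carrier G" for g
    using that by (simp_all add: f_def inv_into_into f_inv_into_f)
  have "f (g \<otimes> h) = f g \<otimes> f h" if gh: "g \<in> H" "h \<in> H" for g h
  proof (rule inj_onD[OF inj])
    have c: "g \<in> carrier G" "h \<in> carrier G" and fixed: "first_level (\<phi> g) y = y"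
      using gh by (simp_all add: H_def)
    then show "\<phi> (f (g \<otimes> h)) = \<phi> (f g \<otimes> f h)"
      using y aut f by (simp add: section_at_mult)
    show "f (g \<otimes> h) \<in> carrier G" "f g \<otimes> f h \<in> carrier G"
      using c f(1) by blast+
  qed
  moreover have "H \<subseteq> carrier G" by (auto simp: H_def)
  ultimately have "f \<in> hom (G\<lparr>carrier := H\<rparr>) G"
    using f(1) by (intro homI) auto
  then show thesis using that f(2) by blast
qed

text \<open>Every element of \<open>K\<close> fixes every word, by induction on the word: the first
  letter is fixed, and the rest is moved by the image of another element of \<open>K\<close>. The
  induction therefore runs over all of \<open>K\<close> at once.\<close>

lemma (in group) invariant_set_trivial:
  assumes \<phi>: "\<phi> \<in> hom G (tree_aut_group m)" and inj: "inj_on \<phi> (carrier G)"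
    and K: "K \<subseteq> carrier G"
    and inv: "\<And>g y. g \<in> K \<Longrightarrow> y < m \<Longrightarrow> first_level (\<phi> g) y = y \<and> (\<exists>h\<in>K. section_at m (\<phi> g) y = \<phi> h)"
    and g: "g \<in> K"
  shows "g = \<one>"
proof -
  interpret \<phi>: group_hom G "tree_aut_group m" \<phi>
    using \<phi> by (intro group_hom.intro group_hom_axioms.intro is_group group_tree_aut_group)
  have aut: "\<phi> g \<in> tree_auts m" if "g \<in> K" for g using \<phi>.hom_closed[of g] K that by auto
  have fix_word: "\<phi> g w = w" if "w \<in> tree_words m" "g \<in> K" for g w
    using that
  proof (induction w arbitrary: g)
    case Nil
    then show ?case using aut[of g] by (simp add: tree_auts_def)
  next
    case (Cons y w)
    then obtain h where h: "h \<in> K" "section_at m (\<phi> g) y = \<phi> h" "first_level (\<phi> g) y = y"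
      using inv[of g y] by auto
    then show ?case using tree_auts_Cons[OF aut[OF Cons.prems(2)], of y w] Cons by simp
  qed
  have "\<phi> g = \<one>\<^bsub>tree_aut_group m\<^esub>"
  proof
    fix w
    \<comment> \<open>Outside the tree both functions take the default value
      \<open>undefined\<close>.\<close>
    have "\<phi> g \<in> extensional (tree_words m)"
      using aut[OF g] by (auto simp: tree_auts_def Bij_def)
    then show "\<phi> g w = \<one>\<^bsub>tree_aut_group m\<^esub> w"
      using fix_word[of w g] g extensional_arb[of "\<phi> g" "tree_words m" w]
      by (cases "w \<in> tree_words m") (simp_all add: tree_aut_group_def)
  qed
  then show ?thesis using inj_onD[OF inj, of g \<one>] K g by auto
qed

section \<open>The universal property of $N_{3,4}$\<close>

context group_hom
begin

lemma hom_commutator: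
  "x \<in> carrier G \<Longrightarrow> y \<in> carrier G \<Longrightarrow> h (commutator G x y) = commutator H (h x) (h y)"
  by (simp add: commutator_def)

lemma hom_commutator3:
  "x \<in> carrier G \<Longrightarrow> y \<in> carrier G \<Longrightarrow> z \<in> carrier G \<Longrightarrow>
    h (commutator3 G x y z) = commutator3 H (h x) (h y) (h z)"
  by (simp add: commutator3_def hom_commutator)

lemma hom_relators34:
  assumes "a \<in> carrier G" "b \<in> carrier G" "c \<in> carrier G" "d \<in> carrier G"
  shows "relators34 H (h a) (h b) (h c) (h d) = h ` relators34 G a b c d"
  using assms
  by (simp add: relators34_def Let_def hom_commutator hom_commutator3)

lemma hom_lower_central: "u \<in> lower_central G n \<Longrightarrow> h u \<in> lower_central H n"
proof (induction n arbitrary: u)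
  case (Suc n)
  let ?S = "{commutator G x y |x y. x \<in> lower_central G n \<and> y \<in> carrier G}"
  have S: "?S \<subseteq> carrier G" using G.lower_central_closed by auto
  have "h ` ?S \<subseteq> {commutator H x y |x y. x \<in> lower_central H n \<and> y \<in> carrier H}"
    using Suc.IH G.lower_central_closed hom_commutator hom_closed by blast
  then have "generate H (h ` ?S) \<subseteq> lower_central H (Suc n)"
    by (simp add: H.mono_generate)
  then show ?case using Suc.prems generate_img[OF S] by auto
qed simp

text \<open>Passes bounds on the nilpotency class from a group to its quotients.\<close>

lemma lower_central_surj:
  assumes surj: "h ` carrier G = carrier H"
  shows "lower_central H n \<subseteq> h ` lower_central G n"
proof (induction n)
  case (Suc n)
  let ?S = "{commutator G x y |x y. x \<in> lower_central G n \<and> y \<in> carrier G}"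
  have S: "?S \<subseteq> carrier G" using G.lower_central_closed by auto
  have "commutator H u v \<in> h ` ?S" if uv: "u \<in> lower_central H n" "v \<in> carrier H" for u v
  proof -
    obtain x where x: "u = h x" "x \<in> lower_central G n" using uv Suc.IH by blast
    obtain y where y: "v = h y" "y \<in> carrier G" using uv surj by blast
    have "commutator H u v = h (commutator G x y)"
      using x y hom_commutator G.lower_central_closed by simp
    then show ?thesis using x(2) y(2) by blast
  qed
  then have "{commutator H x y |x y. x \<in> lower_central H n \<and> y \<in> carrier H} \<subseteq> h ` ?S"
    by blast
  then have "lower_central H (Suc n) \<subseteq> generate H (h ` ?S)" by (simp add: H.mono_generate)
  then show ?case using generate_img[OF S] by simp
qed (simp add: surj)

lemma normal_closure_subset_kernel:
  assumes "S \<subseteq> carrier G" "h ` S \<subseteq> {\<one>\<^bsub>H\<^esub>}"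
  shows "normal_closure G S \<subseteq> kernel G H h"
proof -
  have "S \<subseteq> kernel G H h" using assms by (auto simp: kernel_def)
  then show ?thesis using normal_kernel by (auto simp: normal_closure_def)
qed

lemma generate_surj:
  assumes "h ` carrier G = carrier H" "X \<subseteq> carrier G" "generate G X = carrier G"
  shows "generate H (h ` X) = carrier H"
  using assms generate_img by metis

end

section \<open>Evaluation of words and the universal property of the free group\<close>

context group
begin

lemma subset_normal_closure: "S \<subseteq> normal_closure G S"
  by (auto simp: normal_closure_def)

definition word_eval :: "('x \<Rightarrow> 'a) \<Rightarrow> ('x \<times> bool) list \<Rightarrow> 'a" where
  "word_eval \<eta> w = foldr (\<lambda>(x, e) r. (if e then \<eta> x else inv \<eta> x) \<otimes> r) w \<one>"

lemma word_eval_simps [simp]: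
  "word_eval \<eta> [] = \<one>"
  "word_eval \<eta> ((x, e) # w) = (if e then \<eta> x else inv \<eta> x) \<otimes> word_eval \<eta> w"
  by (simp_all add: word_eval_def)

context
  fixes \<eta> :: "'x \<Rightarrow> 'a"
  assumes \<eta>: "\<And>x. \<eta> x \<in> carrier G"
begin

lemma word_eval_closed [simp]: "word_eval \<eta> w \<in> carrier G"
  by (induction w) (auto simp: \<eta>)

lemma word_eval_append: "word_eval \<eta> (u @ v) = word_eval \<eta> u \<otimes> word_eval \<eta> v"
  by (induction u) (auto simp: \<eta> m_assoc)

lemma word_eval_free_eq: "free_eq u v \<Longrightarrow> word_eval \<eta> u = word_eval \<eta> v"
proof (induction rule: free_eq.induct)
  case (free_eq_cancel u x e v)
  then show ?case by (simp add: word_eval_append \<eta> inv_cancel)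
qed auto

lemma free_group_lift:
  obtains h where "h \<in> hom free_group G" "\<And>x. h (free_gen x) = \<eta> x"
proof
  \<comment> \<open>The choice of a representative is harmless because evaluation is constant on
    free equivalence classes.\<close>
  let ?h = "\<lambda>P. word_eval \<eta> (SOME u. u \<in> P)"
  have h: "?h (free_class u) = word_eval \<eta> u" for u
    using someI[of "\<lambda>v. v \<in> free_class u", OF free_class_self] word_eval_free_eq
    by (simp add: free_class_def)
  show "?h \<in> hom free_group G"
    by (rule homI) (auto simp: free_group_carrier free_group_mult h word_eval_append)
  show "?h (free_gen x) = \<eta> x" for x
    by (simp add: free_gen_def h \<eta>)
qed

end

end

lemma free_group_generate: "generate free_group (range free_gen) = carrier free_group"
proof -
  interpret F: group "free_group :: ('a \<times> bool) list set monoid" by (rule group_free_group)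
  have closed: "range free_gen \<subseteq> carrier free_group"
    by (auto simp: free_gen_def free_group_carrier)
  have "free_class w \<in> generate free_group (range free_gen)" for w :: "('a \<times> bool) list"
  proof (induction w)
    case Nil
    then show ?case using generate.one[of free_group] by (simp add: free_group_one)
  next
    case (Cons l w)
    obtain x e where l: "l = (x, e)" by (cases l)
    have "free_class [(x, e)] \<in> generate free_group (range free_gen)"
    proof (cases e)
      case True
      then show ?thesis using generate.incl[of "free_gen x" "range free_gen" free_group] by (simp add: free_gen_def)
    next
      case False
      have "free_class [(x, False)] \<otimes>\<^bsub>free_group\<^esub> free_gen x = \<one>\<^bsub>free_group\<^esub>"
        using free_eq_cancel[of "[]" x False "[]"]
        by (simp add: free_gen_def free_group_mult free_group_one free_class_eq_iff)
      then have "inv\<^bsub>free_group\<^esub> free_gen x = free_class [(x, False)]"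
        by (rule F.inv_equality) (auto simp: free_gen_def free_group_carrier)
      then show ?thesis using False generate.inv[of "free_gen x" "range free_gen" free_group] by simp
    qed
    from generate.eng[OF this Cons] show ?case by (simp add: l free_group_mult)
  qed
  then show ?thesis using F.generate_incl[OF closed] by (auto simp: free_group_carrier)
qed

definition N34_gen :: "gen4 \<Rightarrow> (gen4 \<times> bool) list set set set" where
  "N34_gen x = normal_closure (free_nilpotent 3)
     (relators34 (free_nilpotent 3)
        (free_nilpotent_gen 3 GenA) (free_nilpotent_gen 3 GenB)
        (free_nilpotent_gen 3 GenC) (free_nilpotent_gen 3 GenD))
     #>\<^bsub>free_nilpotent 3\<^esub> free_nilpotent_gen 3 x"

lemma (in normal) group_hom_r_coset: "group_hom G (G Mod H) (\<lambda>x. H #> x)"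
  by (intro group_hom.intro group_hom_axioms.intro factorgroup_is_group is_group r_coset_hom_Mod)

lemma (in normal) r_coset_surj: "(\<lambda>x. H #> x) ` carrier G = carrier (G Mod H)"
  by (auto simp: carrier_FactGroup)

text \<open>The presentation turned into a universal property. A lift passes through the two
  quotients in turn: class at most three kills \<open>?L\<close>, the relators kill
  \<open>?K\<close>. The other claims travel along the same two projections \<open>?p\<close> and
  \<open>?q\<close>, so all are proved together.\<close>

lemma N34_presentation:
  shows N34_lift: "\<lbrakk>group M; lower_central M 3 = {\<one>\<^bsub>M\<^esub>}; \<And>x. \<eta> x \<in> carrier M;
      relators34 M (\<eta> GenA) (\<eta> GenB) (\<eta> GenC) (\<eta> GenD) \<subseteq> {\<one>\<^bsub>M\<^esub>}\<rbrakk>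
      \<Longrightarrow> \<exists>\<psi>. \<psi> \<in> hom N34 M \<and> (\<forall>x. \<psi> (N34_gen x) = \<eta> x)"
    and N34_relators: "relators34 N34 (N34_gen GenA) (N34_gen GenB) (N34_gen GenC) (N34_gen GenD)
      \<subseteq> {\<one>\<^bsub>N34\<^esub>}"
    and N34_generate: "generate N34 (range N34_gen) = carrier N34"
    and N34_lower_central: "lower_central N34 3 = {\<one>\<^bsub>N34\<^esub>}"
    and N34_gen_closed: "N34_gen x \<in> carrier N34"
proof -
  let ?F = "free_group :: (gen4 \<times> bool) list set monoid"
  let ?L = "lower_central ?F 3"
  let ?P = "free_nilpotent 3 :: (gen4 \<times> bool) list set set monoid"
  let ?g = "free_nilpotent_gen 3 :: gen4 \<Rightarrow> (gen4 \<times> bool) list set set"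
  let ?R = "relators34 ?P (?g GenA) (?g GenB) (?g GenC) (?g GenD)"
  let ?K = "normal_closure ?P ?R"
  have P: "?P = ?F Mod ?L" by (simp add: free_nilpotent_def)
  have N: "N34 = ?P Mod ?K" by (simp add: N34_def)
  interpret F: group ?F by (rule group_free_group)
  interpret P: group ?P by (rule group_free_nilpotent)
  interpret N: group N34 by (rule group_N34)
  interpret L: normal ?L ?F by (rule F.normal_lower_central)
  have Rc: "?R \<subseteq> carrier ?P" by (intro P.relators34_closed free_nilpotent_gen_closed)
  interpret K: normal ?K ?P by (rule P.normal_normal_closure[OF Rc])
  let ?p = "\<lambda>x. ?L #>\<^bsub>?F\<^esub> x" and ?q = "\<lambda>x. ?K #>\<^bsub>?P\<^esub> x"
  interpret p: group_hom ?F ?P ?p using L.group_hom_r_coset P by simp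
  interpret q: group_hom ?P N34 ?q using K.group_hom_r_coset N by simp
  have ps: "?p ` carrier ?F = carrier ?P" using L.r_coset_surj P by simp
  have qs: "?q ` carrier ?P = carrier N34" using K.r_coset_surj N by simp
  have pg: "?g x = ?p (free_gen x)" for x by (simp add: free_nilpotent_gen_def)
  have qg: "N34_gen x = ?q (?g x)" for x by (simp add: N34_gen_def)
  have fc: "free_gen x \<in> carrier ?F" for x by (simp add: free_gen_def free_group_carrier)
  have gc: "?g x \<in> carrier ?P" for x by (rule free_nilpotent_gen_closed)
  show Nc: "N34_gen x \<in> carrier N34" for x using qg gc q.hom_closed by simp
  have "generate ?P (?p ` range free_gen) = carrier ?P"
    using fc by (intro p.generate_surj ps free_group_generate) auto
  then have Pg: "generate ?P (range ?g) = carrier ?P" by (simp add: image_image pg)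
  have "generate N34 (?q ` range ?g) = carrier N34"
    using gc by (intro q.generate_surj qs Pg) auto
  then show "generate N34 (range N34_gen) = carrier N34" by (simp add: image_image qg)
  \<comment> \<open>The fourth term of the lower central series dies in the first quotient, and by
    surjectivity of the projections nothing new appears in either quotient.\<close>
  have "?p x = \<one>\<^bsub>?P\<^esub>" if "x \<in> ?L" for x
    using L.rcos_const[OF group_free_group that] unfolding P one_FactGroup .
  then have P3: "lower_central ?P 3 \<subseteq> {\<one>\<^bsub>?P\<^esub>}"
    using p.lower_central_surj[OF ps, of 3] by blast
  then have "lower_central N34 3 \<subseteq> {\<one>\<^bsub>N34\<^esub>}"
    using q.lower_central_surj[OF qs, of 3] q.hom_one by blast
  then show "lower_central N34 3 = {\<one>\<^bsub>N34\<^esub>}"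
    using subgroup.one_closed[OF N.subgroup_lower_central, of 3] by blast
  have "?q x = \<one>\<^bsub>N34\<^esub>" if "x \<in> ?R" for x
  proof -
    have "x \<in> ?K" using P.subset_normal_closure that by blast
    from K.rcos_const[OF P.is_group this] show ?thesis unfolding N one_FactGroup .
  qed
  then show "relators34 N34 (N34_gen GenA) (N34_gen GenB) (N34_gen GenC) (N34_gen GenD)
      \<subseteq> {\<one>\<^bsub>N34\<^esub>}"
    unfolding qg q.hom_relators34[OF gc gc gc gc] by blast
  assume M: "group M" "lower_central M 3 = {\<one>\<^bsub>M\<^esub>}" "\<And>x. \<eta> x \<in> carrier M"
      "relators34 M (\<eta> GenA) (\<eta> GenB) (\<eta> GenC) (\<eta> GenD) \<subseteq> {\<one>\<^bsub>M\<^esub>}"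
  interpret M: group M by (rule M)
  obtain h where h: "h \<in> hom ?F M" "\<And>x. h (free_gen x) = \<eta> x"
    using M.free_group_lift M(3) by blast
  interpret h: group_hom ?F M h by unfold_locales (rule h)
  have "?L \<subseteq> kernel ?F M h"
    using h.hom_lower_central[of _ 3] M(2) F.lower_central_closed by (auto simp: kernel_def)
  then obtain k where k: "k \<in> hom ?P M" "\<And>x. x \<in> carrier ?F \<Longrightarrow> k (?p x) = h x"
    using h.FactGroup_universal_kernel[OF L.normal_axioms] P by metis
  interpret k: group_hom ?P M k by unfold_locales (rule k)
  have kg: "k (?g x) = \<eta> x" for x using k(2)[OF fc] h(2) pg by simp
  have "k ` ?R \<subseteq> {\<one>\<^bsub>M\<^esub>}"
    using k.hom_relators34[OF gc gc gc gc] M(4) by (simp add: kg)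
  then obtain l where l: "l \<in> hom N34 M" "\<And>x. x \<in> carrier ?P \<Longrightarrow> l (?q x) = k x"
    using k.FactGroup_universal_kernel[OF K.normal_axioms k.normal_closure_subset_kernel[OF Rc]] N
    by metis
  then show "\<exists>\<psi>. \<psi> \<in> hom N34 M \<and> (\<forall>x. \<psi> (N34_gen x) = \<eta> x)"
    using gc qg kg by auto
qed

section \<open>The third term of the lower central series\<close>

context class3_group
begin

text \<open>For central \<open>p\<close> and a subgroup \<open>S\<close> this is the subgroup
  generated by both. The explicit form supplies the exponents that
  \<open>coord_trivial_kernel\<close> compares with coordinates.\<close>

definition adjoin :: "'a \<Rightarrow> 'a set \<Rightarrow> 'a set" where
  "adjoin p S = {p [^] (i :: int) \<otimes> s |i s. s \<in> S}"

lemma adjoinI: "s \<in> S \<Longrightarrow> p [^] (i :: int) \<otimes> s \<in> adjoin p S"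
  unfolding adjoin_def by blast

lemma adjoinE:
  assumes "u \<in> adjoin p S"
  obtains i s where "u = p [^] (i :: int) \<otimes> s" "s \<in> S"
  using assms unfolding adjoin_def by blast

lemma subgroup_adjoin:
  assumes p: "p \<in> lower_central G 2" and S: "subgroup S G"
  shows "subgroup (adjoin p S) G" "S \<subseteq> adjoin p S" "p \<in> adjoin p S"
proof -
  interpret S: subgroup S G by (rule S)
  have pc: "p \<in> carrier G" using p lower_central_closed by blast
  have "p [^] i \<in> lower_central G 2" for i :: int
    using p subgroup_int_pow_closed[OF subgroup_lower_central] by blast
  then have comm: "p [^] i \<otimes> g = g \<otimes> p [^] i" if "g \<in> carrier G" for g and i :: int
    using lower_central_2_central that by blast
  show "subgroup (adjoin p S) G"
  proof (rule subgroupI)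
    show "adjoin p S \<subseteq> carrier G" using pc by (auto elim!: adjoinE)
    show "adjoin p S \<noteq> {}" using adjoinI[OF S.one_closed] by blast
  next
    fix u assume "u \<in> adjoin p S"
    then obtain i s where u: "u = p [^] (i :: int) \<otimes> s" "s \<in> S" by (rule adjoinE)
    then have "inv u = p [^] (- i) \<otimes> inv s"
      using pc comm[of "inv s" "- i"] by (simp add: inv_mult_group int_pow_neg)
    then show "inv u \<in> adjoin p S" using u by (simp add: adjoinI)
  next
    fix u v assume "u \<in> adjoin p S" "v \<in> adjoin p S"
    then obtain i s j t where u: "u = p [^] (i :: int) \<otimes> s" "s \<in> S"
      and v: "v = p [^] (j :: int) \<otimes> t" "t \<in> S" by (elim adjoinE)
    have "u \<otimes> v = p [^] i \<otimes> (s \<otimes> p [^] j) \<otimes> t" using u v pc by (simp add: m_assoc)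
    also have "s \<otimes> p [^] j = p [^] j \<otimes> s" using comm[of s j] u(2) by simp
    also have "p [^] i \<otimes> (p [^] j \<otimes> s) \<otimes> t = p [^] (i + j) \<otimes> (s \<otimes> t)"
      using u(2) v(2) pc by (simp add: m_assoc int_pow_mult)
    finally show "u \<otimes> v \<in> adjoin p S" using u v by (simp add: adjoinI)
  qed
  show "S \<subseteq> adjoin p S"
    using adjoinI[of _ S p 0] by (simp add: subset_iff)
  show "p \<in> adjoin p S"
    using adjoinI[OF S.one_closed, of p 1] pc by simp
qed

context
  fixes a b c d
  assumes closed: "a \<in> carrier G" "b \<in> carrier G" "c \<in> carrier G" "d \<in> carrier G"
    and rel: "relators34 G a b c d \<subseteq> {\<one>}"
begin

text \<open>The relators in left-normed form, through \<open>[x, [y, z]] = [y, z, x]^-1\<close>. The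
  last two identities are consequences: \<open>[c, d]\<close> is the inverse of a triple commutator,
  hence central, and \<open>commutator3_comm\<close> exchanges the last two slots.\<close>

lemma relators34_commutator3:
  shows "commutator G a b = commutator3 G a c c" "commutator G c d = inv (commutator3 G a c a)"
    "commutator3 G b c b = \<one>" "commutator3 G a d d = \<one>"
    "commutator3 G b c a = commutator3 G a c b" "commutator3 G b d a = commutator3 G a d b"
    "commutator3 G b c c = inv (commutator3 G a d a)" "commutator3 G b d b = commutator3 G a c a"
    "commutator3 G b d d = commutator3 G a c b" "commutator3 G b d c = commutator3 G a c c"
    "commutator3 G a d c = commutator3 G a d b"
    "commutator3 G a c d = commutator3 G a d b" "commutator3 G b c d = commutator3 G a c c"
proof -
  let ?K = "commutator G" and ?T = "commutator3 G"
  have K: "?K x (?K y z) = inv (?T y z x)" if "x \<in> carrier G" "y \<in> carrier G" "z \<in> carrier G" for x y z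
    using that commutator_swap[of "?K y z" x] by (simp add: commutator3_def)
  have eq: "x = y" if "x \<otimes> inv y = \<one>" "x \<in> carrier G" "y \<in> carrier G" for x y
    using inv_equality[OF that(1)] that by simp
  have eq': "x = y" if "inv x \<otimes> y = \<one>" "x \<in> carrier G" "y \<in> carrier G" for x y
    using inv_equality[OF that(1)] that by (metis inv_closed inv_inv)
  have r: "?K b (?K b c) = \<one>" "?T a d d = \<one>"
      "?K a (?K b c) \<otimes> ?T a c b = \<one>" "?K a (?K b d) \<otimes> ?T a d b = \<one>"
      "?K a (?K a d) \<otimes> inv (?T b c c) = \<one>" "?K a (?K a c) \<otimes> inv (?K b (?K b d)) = \<one>"
      "?T a c b \<otimes> inv (?T b d d) = \<one>" "?T a c c \<otimes> inv (?T b d c) = \<one>"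
      "?T a d b \<otimes> inv (?T a d c) = \<one>" "?K a b \<otimes> inv (?T a c c) = \<one>"
      "?K c d \<otimes> inv (?K a (?K a c)) = \<one>"
    using rel unfolding relators34_def Let_def by (simp_all only: insert_subset singleton_iff)
  note r' = r[unfolded K[OF closed(1,2,3)] K[OF closed(1,2,4)] K[OF closed(2,2,3)]
      K[OF closed(1,1,4)] K[OF closed(1,1,3)] K[OF closed(2,2,4)]]
  show 1: "?K a b = ?T a c c" "?K c d = inv (?T a c a)"
    using eq[OF r'(10)] eq[OF r'(11)] closed by simp_all
  show "?T b c b = \<one>" "?T a d d = \<one>"
    using r'(1,2) closed by simp_all
  show "?T b c a = ?T a c b" "?T b d a = ?T a d b"
    using eq'[OF r'(3)] eq'[OF r'(4)] closed by simp_all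
  show "?T b c c = inv (?T a d a)"
    using eq[OF r'(5)] closed by simp
  show "?T b d b = ?T a c a"
    using eq[OF r'(6)] closed by (metis inv_inv inv_closed commutator3_closed)
  show 4: "?T b d d = ?T a c b" "?T b d c = ?T a c c" "?T a d c = ?T a d b"
    using eq[OF r'(7)] eq[OF r'(8)] eq[OF r'(9)] closed by simp_all
  have "inv (?T a c a) \<in> lower_central G 2"
    using closed commutator3_in_2 subgroup.m_inv_closed[OF subgroup_lower_central] by blast
  then have "?K c d \<in> lower_central G 2" using 1 by simp
  then have "?T x c d = ?T x d c" if "x \<in> carrier G" for x
    using commutator3_comm that closed by blast
  then show "?T a c d = ?T a d b" "?T b c d = ?T a c c"
    using 4 closed by simp_all
qed

text \<open>Five elements suffice for the 64 triple commutators of generators: those starting with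
  \<open>[x, x]\<close>, \<open>[a, b]\<close> or \<open>[c, d]\<close> vanish, those with first
  entry in \<open>{a, b}\<close> and second in \<open>{c, d}\<close> are reduced by the relators,
  and exchanging the first two entries inverts.\<close>

lemma lower_central_2_span:
  assumes gen: "generate G {a, b, c, d} = carrier G"
  shows "lower_central G 2 \<subseteq> adjoin (commutator3 G a c a) (adjoin (commutator3 G a c b)
    (adjoin (commutator3 G a c c) (adjoin (commutator3 G a d a) (adjoin (commutator3 G a d b) {\<one>}))))"
proof -
  let ?T = "commutator3 G"
  note in2 = commutator3_in_2
  define S5 where "S5 = adjoin (?T a d b) {\<one>}"
  define S4 where "S4 = adjoin (?T a d a) S5"
  define S3 where "S3 = adjoin (?T a c c) S4"
  define S2 where "S2 = adjoin (?T a c b) S3"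
  define S where "S = adjoin (?T a c a) S2"
  note s5 = subgroup_adjoin[OF in2 triv_subgroup, of a d b, folded S5_def, OF closed(1,4,2)]
  note s4 = subgroup_adjoin[OF in2 s5(1), of a d a, folded S4_def, OF closed(1,4,1)]
  note s3 = subgroup_adjoin[OF in2 s4(1), of a c c, folded S3_def, OF closed(1,3,3)]
  note s2 = subgroup_adjoin[OF in2 s3(1), of a c b, folded S2_def, OF closed(1,3,2)]
  note s1 = subgroup_adjoin[OF in2 s2(1), of a c a, folded S_def, OF closed(1,3,1)]
  interpret S: subgroup S G by (rule s1(1))
  have mem: "?T a c a \<in> S" "?T a c b \<in> S" "?T a c c \<in> S" "?T a d a \<in> S" "?T a d b \<in> S"
    using s1 s2 s3 s4 s5 by blast+
  have central: "commutator G u z = \<one>" if "u \<in> lower_central G 2" "z \<in> carrier G" for u z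
    using that lower_central_2_central lower_central_closed commutator_eq_one_iff by blast
  \<comment> \<open>Up to inversion \<open>[a, b]\<close> and \<open>[c, d]\<close> are themselves
    triple commutators, hence central.\<close>
  have "?T a b z = \<one>" "?T c d z = \<one>" if "z \<in> carrier G" for z
    using that closed central[of "?T a c c" z] central[of "inv (?T a c a)" z]
      in2 subgroup.m_inv_closed[OF subgroup_lower_central, of _ 2]
    by (simp_all add: commutator3_def[of _ a b z] commutator3_def[of _ c d z] relators34_commutator3)
  then have half: "?T a b z \<in> S" "?T c d z \<in> S" "?T a c z \<in> S" "?T a d z \<in> S" "?T b c z \<in> S" "?T b d z \<in> S"
    if "z \<in> {a, b, c, d}" for z
    using that by (elim insertE emptyE; simp add: mem closed relators34_commutator3)+
  have swap: "?T y x z \<in> S" if "?T x y z \<in> S" "x \<in> carrier G" "y \<in> carrier G" "z \<in> carrier G" for x y z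
  proof -
    have "?T y x z = inv (?T x y z)"
      using that commutator_swap[of x y] commutator_derived_inv_left[of "commutator G x y" z]
      by (simp add: commutator3_def commutator_in_1 del: One_nat_def)
    then show ?thesis using that by simp
  qed
  have "?T x x z \<in> S" if "x \<in> carrier G" "z \<in> carrier G" for x z
    using that by (simp add: commutator3_def)
  note self = this
  have "?T x y z \<in> S" if x: "x \<in> {a, b, c, d}" and y: "y \<in> {a, b, c, d}" and z: "z \<in> {a, b, c, d}" for x y z
  proof -
    have zc: "z \<in> carrier G" using z closed by blast
    note h = half[OF z]
    note swapped = swap[OF h(1) closed(1,2) zc] swap[OF h(2) closed(3,4) zc]
      swap[OF h(3) closed(1,3) zc] swap[OF h(4) closed(1,4) zc]
      swap[OF h(5) closed(2,3) zc] swap[OF h(6) closed(2,4) zc]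
    show ?thesis
      using x y by (elim insertE emptyE) (simp_all only: h swapped self closed zc)
  qed
  from lower_central_2_subset[OF _ gen s1(1) this] closed
  show ?thesis by (simp add: S_def S2_def S3_def S4_def S5_def)
qed

end

end

section \<open>A concrete model\<close>

text \<open>
  Malcev coordinates for $N_{3,4}$, one for each of: the generators, the four commutators \<open>[x, y]\<close> with
  \<open>x \<in> {a, b}\<close> and \<open>y \<in> {c, d}\<close>, and the five independent triple commutators
  \<open>P1 = [a,c,a] = [b,d,b]\<close>, \<open>P2 = [a,c,b] = [b,c,a] = [b,d,d]\<close>, \<open>P3 = [a,c,c] = [b,c,d] = [b,d,c]\<close>,
  \<open>P4 = [a,d,a] = [b,c,c]\<inverse>\<close>, \<open>P5 = [a,d,b] = [b,d,a] = [a,c,d] = [a,d,c]\<close>; moreover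
  \<open>[a,b] = P3\<close> and \<open>[c,d] = P1\<inverse>\<close>.  The last five coordinates are doubled, so that the multiplication
  below, whose cubic part contains terms such as \<open>a\<^sup>2c'/2\<close>, has integer coefficients.
\<close>

datatype malcev = Malcev (cA: int) (cB: int) (cC: int) (cD: int)
  (cAC: int) (cAD: int) (cBC: int) (cBD: int)
  (cP1: int) (cP2: int) (cP3: int) (cP4: int) (cP5: int)

text \<open>Applied to two of the first four selectors, this is a coordinate of the bivector spanned
  by the abelianised \<open>x\<close> and \<open>y\<close>.\<close>

definition minor :: "(malcev \<Rightarrow> int) \<Rightarrow> (malcev \<Rightarrow> int) \<Rightarrow> malcev \<Rightarrow> malcev \<Rightarrow> int" where
  "minor s t x y = s x * t y - s y * t x"

text \<open>The triple commutator \<open>[x, y, z]\<close> in these coordinates, see \<open>commutator3_malcev\<close>.\<close>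

definition tri :: "malcev \<Rightarrow> malcev \<Rightarrow> malcev \<Rightarrow> malcev" where
  "tri x y z = Malcev 0 0 0 0 0 0 0 0
     (2 * (minor cA cC x y * cA z + minor cB cD x y * cB z))
     (2 * (minor cA cC x y * cB z + minor cB cC x y * cA z + minor cB cD x y * cD z))
     (2 * (minor cA cC x y * cC z + minor cB cC x y * cD z + minor cB cD x y * cC z))
     (2 * (minor cA cD x y * cA z - minor cB cC x y * cC z))
     (2 * (minor cA cD x y * cB z + minor cB cD x y * cA z
         + minor cA cC x y * cD z + minor cA cD x y * cC z))"

definition malcev_one :: malcev where
  "malcev_one = Malcev 0 0 0 0 0 0 0 0 0 0 0 0 0"

text \<open>Agrees with the power map on the generators and on \<open>malcev_deg2\<close>, where no
  mixed terms arise.\<close>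

definition scale :: "int \<Rightarrow> malcev \<Rightarrow> malcev" where
  "scale r x = Malcev (r * cA x) (r * cB x) (r * cC x) (r * cD x)
     (r * cAC x) (r * cAD x) (r * cBC x) (r * cBD x)
     (r * cP1 x) (r * cP2 x) (r * cP3 x) (r * cP4 x) (r * cP5 x)"

text \<open>The terms \<open>- 2 * c * d'\<close> in \<open>P1\<close> and \<open>2 * a * b'\<close>
  in \<open>P3\<close> encode the inhomogeneous relators for \<open>[c, d]\<close> and
  \<open>[a, b]\<close>; the other mixed terms of the last five coordinates account for the triple
  commutators.\<close>

fun malcev_mult :: "malcev \<Rightarrow> malcev \<Rightarrow> malcev" where
  "malcev_mult (Malcev a b c d ac ad bc bd p1 p2 p3 p4 p5)
               (Malcev a' b' c' d' ac' ad' bc' bd' p1' p2' p3' p4' p5') =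
   Malcev (a + a') (b + b') (c + c') (d + d')
     (ac + ac' + a * c') (ad + ad' + a * d') (bc + bc' + b * c') (bd + bd' + b * d')
     (p1 + p1' + (2 * ac * a' + a * a * c' + 2 * a * a' * c')
               + (2 * bd * b' + b * b * d' + 2 * b * b' * d') - 2 * c * d')
     (p2 + p2' + (2 * ac * b' + 2 * bc * a' + 2 * a * b * c' + 2 * (a * b' + b * a') * c')
               + (2 * bd * d' + b * d' * d'))
     (p3 + p3' + (2 * ac * c' + a * c' * c')
               + (2 * bc * d' + 2 * bd * c' + 2 * b * c' * d') + 2 * a * b')
     (p4 + p4' + (2 * ad * a' + a * a * d' + 2 * a * a' * d')
               - (2 * bc * c' + b * c' * c'))
     (p5 + p5' + (2 * ad * b' + 2 * bd * a' + 2 * a * b * d' + 2 * (a * b' + b * a') * d')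
               + (2 * ac * d' + 2 * ad * c' + 2 * a * c' * d'))"

text \<open>The first eight coordinates are inverted directly. The product of that approximation
  with the element has only the central coordinates \<open>q1\<close> to \<open>q5\<close>, which
  are then subtracted.\<close>

fun malcev_inv :: "malcev \<Rightarrow> malcev" where
  "malcev_inv (Malcev a b c d ac ad bc bd p1 p2 p3 p4 p5) =
   (case malcev_mult (Malcev (- a) (- b) (- c) (- d) (a * c - ac) (a * d - ad) (b * c - bc) (b * d - bd) 0 0 0 0 0)
          (Malcev a b c d ac ad bc bd p1 p2 p3 p4 p5) of
     Malcev _ _ _ _ _ _ _ _ q1 q2 q3 q4 q5 \<Rightarrow>
      Malcev (- a) (- b) (- c) (- d) (a * c - ac) (a * d - ad) (b * c - bc) (b * d - bd)
         (- q1) (- q2) (- q3) (- q4) (- q5))"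

definition malcev_group :: "malcev monoid" where
  "malcev_group = \<lparr>carrier = UNIV, mult = malcev_mult, one = malcev_one\<rparr>"

lemma malcev_group_simps [simp]:
  "carrier malcev_group = UNIV" "mult malcev_group = malcev_mult" "one malcev_group = malcev_one"
  by (simp_all add: malcev_group_def)

lemma malcev_mult_assoc: "malcev_mult (malcev_mult x y) z = malcev_mult x (malcev_mult y z)"
  by (cases x; cases y; cases z) (simp add: algebra_simps)

lemma malcev_inv_left: "malcev_mult (malcev_inv x) x = malcev_one"
  by (cases x) (simp add: malcev_one_def algebra_simps)

lemma malcev_one_mult [simp]: "malcev_mult malcev_one x = x" "malcev_mult x malcev_one = x"
  by (cases x; simp add: malcev_one_def)+

lemma group_malcev_group: "group malcev_group"
  by (rule groupI) (auto simp: malcev_mult_assoc intro: malcev_inv_left)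

interpretation malcev: group malcev_group
  by (rule group_malcev_group)

text \<open>Right multiplication by an element with vanishing first four coordinates merely adds
  coordinates, so the solution \<open>w\<close> of \<open>y x w = x y\<close> is a coordinatewise
  difference.\<close>

definition malcev_commutator :: "malcev \<Rightarrow> malcev \<Rightarrow> malcev" where
  "malcev_commutator x y = (let u = malcev_mult x y; v = malcev_mult y x in
     Malcev 0 0 0 0 (cAC u - cAC v) (cAD u - cAD v) (cBC u - cBC v) (cBD u - cBD v)
       (cP1 u - cP1 v) (cP2 u - cP2 v) (cP3 u - cP3 v) (cP4 u - cP4 v) (cP5 u - cP5 v))"

definition malcev_deg2 :: "malcev set" where
  "malcev_deg2 = {x. cA x = 0 \<and> cB x = 0 \<and> cC x = 0 \<and> cD x = 0}"

lemma malcev_commutator_sel: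
  "cAC (malcev_commutator x y) = minor cA cC x y" "cAD (malcev_commutator x y) = minor cA cD x y"
  "cBC (malcev_commutator x y) = minor cB cC x y" "cBD (malcev_commutator x y) = minor cB cD x y"
  "malcev_commutator x y \<in> malcev_deg2"
proof -
  have "cAC (malcev_mult u v) = cAC u + cAC v + cA u * cC v"
    "cAD (malcev_mult u v) = cAD u + cAD v + cA u * cD v"
    "cBC (malcev_mult u v) = cBC u + cBC v + cB u * cC v"
    "cBD (malcev_mult u v) = cBD u + cBD v + cB u * cD v" for u v
    by (cases u, cases v, simp)+
  then show "cAC (malcev_commutator x y) = minor cA cC x y" "cAD (malcev_commutator x y) = minor cA cD x y"
    "cBC (malcev_commutator x y) = minor cB cC x y" "cBD (malcev_commutator x y) = minor cB cD x y"
    by (simp_all add: malcev_commutator_def Let_def minor_def)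
  show "malcev_commutator x y \<in> malcev_deg2"
    by (simp add: malcev_commutator_def Let_def malcev_deg2_def)
qed

text \<open>The trace of \<open>[a, b] = P3\<close> for multiples of \<open>a\<close> and
  \<open>b\<close> modulo the derived subgroup. It is quadratic in the multiples, while
  \<open>[a, c, c]\<close> is cubic; this discrepancy later determines the scalar.\<close>

lemma malcev_commutator_AB:
  assumes "cB x = 0" "cC x = 0" "cD x = 0" "cA y = 0" "cC y = 0" "cD y = 0"
  shows "cP3 (malcev_commutator x y) = 2 * cA x * cB y"
  using assms by (cases x; cases y) (simp add: malcev_commutator_def)

text \<open>Both sides solve \<open>y x w = x y\<close>, and \<open>y x\<close> can be
  cancelled.\<close>

lemma commutator_malcev: "commutator malcev_group x y = malcev_commutator x y"
proof -
  have "malcev_mult (malcev_mult y x) (malcev_commutator x y) = malcev_mult x y"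
    by (cases x; cases y) (simp add: malcev_commutator_def algebra_simps)
  moreover have "malcev_mult (malcev_mult y x) (commutator malcev_group x y) = malcev_mult x y"
    using malcev.inv_solve_left[of x "commutator malcev_group x y"]
    by (metis UNIV_I commutator_def group.inv_mult_group group_malcev_group malcev.inv_closed
        malcev.l_inv malcev.m_assoc malcev.m_closed malcev.r_inv malcev.r_one malcev.l_one malcev_group_simps)
  ultimately show ?thesis by (metis UNIV_I malcev.Units_eq malcev.Units_l_cancel malcev_group_simps(1,2))
qed

lemma commutator3_malcev: "commutator3 malcev_group x y z = tri x y z"
  unfolding commutator3_def commutator_malcev
  by (cases x; cases y; cases z) (simp add: malcev_commutator_def tri_def minor_def algebra_simps)

lemma malcev_inv_eq [simp]: "inv\<^bsub>malcev_group\<^esub> x = malcev_inv x"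
  by (rule malcev.inv_equality) (simp_all add: malcev_inv_left)

lemma subgroup_malcevI:
  assumes "malcev_one \<in> S" "\<And>x y. x \<in> S \<Longrightarrow> y \<in> S \<Longrightarrow> malcev_mult x y \<in> S"
    "\<And>x. x \<in> S \<Longrightarrow> malcev_inv x \<in> S"
  shows "subgroup S malcev_group"
  using assms by (intro malcev.subgroupI) auto

section \<open>Lower central series and powers in the model\<close>

definition malcev_deg3 :: "malcev set" where
  "malcev_deg3 = {x \<in> malcev_deg2. cAC x = 0 \<and> cAD x = 0 \<and> cBC x = 0 \<and> cBD x = 0}"

lemma subgroup_malcev_deg2: "subgroup malcev_deg2 malcev_group"
proof (rule subgroup_malcevI)
  show "malcev_mult x y \<in> malcev_deg2" if "x \<in> malcev_deg2" "y \<in> malcev_deg2" for x y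
    using that by (cases x; cases y) (simp add: malcev_deg2_def)
  show "malcev_inv x \<in> malcev_deg2" if "x \<in> malcev_deg2" for x
    using that by (cases x) (simp add: malcev_deg2_def)
qed (simp add: malcev_deg2_def malcev_one_def)

lemma subgroup_malcev_deg3: "subgroup malcev_deg3 malcev_group"
proof (rule subgroup_malcevI)
  show "malcev_mult x y \<in> malcev_deg3" if "x \<in> malcev_deg3" "y \<in> malcev_deg3" for x y
    using that by (cases x; cases y) (simp add: malcev_deg2_def malcev_deg3_def)
  show "malcev_inv x \<in> malcev_deg3" if "x \<in> malcev_deg3" for x
    using that by (cases x) (simp add: malcev_deg2_def malcev_deg3_def)
qed (simp add: malcev_deg2_def malcev_deg3_def malcev_one_def)

lemma lower_central_malcev_1: "lower_central malcev_group (Suc 0) \<subseteq> malcev_deg2"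
  by (rule malcev.lower_central_Suc_subsetI[OF subgroup_malcev_deg2])
    (simp add: commutator_malcev malcev_commutator_sel)

lemma lower_central_malcev_2: "lower_central malcev_group (Suc (Suc 0)) \<subseteq> malcev_deg3"
proof (rule malcev.lower_central_Suc_subsetI[OF subgroup_malcev_deg3])
  fix x y assume "x \<in> lower_central malcev_group (Suc 0)"
  then have "x \<in> malcev_deg2" using lower_central_malcev_1 by blast
  then show "commutator malcev_group x y \<in> malcev_deg3"
    by (simp add: commutator_malcev malcev_deg3_def malcev_commutator_sel minor_def)
      (simp add: malcev_deg2_def)
qed

lemma lower_central_malcev_3: "lower_central malcev_group 3 = {malcev_one}"
proof
  have "malcev_commutator x y = malcev_one" if "x \<in> malcev_deg3" for x y
    using that by (cases x; cases y)
      (simp add: malcev_commutator_def malcev_deg2_def malcev_deg3_def malcev_one_def)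
  then have "lower_central malcev_group (Suc (Suc (Suc 0))) \<subseteq> {malcev_one}"
    using lower_central_malcev_2 malcev.triv_subgroup
    by (intro malcev.lower_central_Suc_subsetI) (auto simp: commutator_malcev simp del: lower_central.simps)
  then show "lower_central malcev_group 3 \<subseteq> {malcev_one}" by (simp only: numeral_3_eq_3)
  show "{malcev_one} \<subseteq> lower_central malcev_group 3"
    using subgroup.one_closed[OF malcev.subgroup_lower_central, of 3] by simp
qed

lemma malcev_pow_eq_scale:
  assumes "\<And>k. malcev_mult (scale k x) x = scale (k + 1) x"
  shows "x [^]\<^bsub>malcev_group\<^esub> (n :: nat) = scale (int n) x"
proof (induction n)
  case 0
  then show ?case by (simp add: scale_def malcev_one_def)
next
  case (Suc n)
  then show ?case using assms[of "int n"] by (simp add: add.commute)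
qed

lemma malcev_pow_deg2:
  "x \<in> malcev_deg2 \<Longrightarrow> x [^]\<^bsub>malcev_group\<^esub> (n :: nat) = scale (int n) x"
  by (rule malcev_pow_eq_scale, cases x) (simp add: malcev_deg2_def scale_def algebra_simps)

lemma malcev_int_pow_deg2:
  assumes "x \<in> malcev_deg2"
  shows "x [^]\<^bsub>malcev_group\<^esub> (i :: int) = scale i x"
proof -
  have "malcev_inv (scale k x) = scale (- k) x" for k
    using assms by (cases x) (simp add: malcev_deg2_def scale_def)
  then show ?thesis by (simp add: int_pow_def2 malcev_pow_deg2[OF assms])
qed

primrec malcev_gen :: "gen4 \<Rightarrow> malcev" where
  "malcev_gen GenA = Malcev 1 0 0 0 0 0 0 0 0 0 0 0 0"
| "malcev_gen GenB = Malcev 0 1 0 0 0 0 0 0 0 0 0 0 0"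
| "malcev_gen GenC = Malcev 0 0 1 0 0 0 0 0 0 0 0 0 0"
| "malcev_gen GenD = Malcev 0 0 0 1 0 0 0 0 0 0 0 0 0"

lemma malcev_gen_pow: "malcev_gen g [^]\<^bsub>malcev_group\<^esub> (n :: nat) = scale (int n) (malcev_gen g)"
  by (rule malcev_pow_eq_scale, cases g) (simp_all add: scale_def)

lemma relators34_malcev:
  "relators34 malcev_group (malcev_gen GenA) (malcev_gen GenB) (malcev_gen GenC) (malcev_gen GenD)
     \<subseteq> {malcev_one}"
  by (simp add: relators34_def Let_def commutator3_malcev commutator_malcev
      malcev_commutator_def tri_def minor_def
      malcev_one_def)

section \<open>Coordinates on \<open>N34\<close>\<close>

interpretation N34: class3_group N34
  by (intro class3_group.intro class3_group_axioms.intro group_N34 N34_lower_central)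

definition N34_coord :: "(gen4 \<times> bool) list set set set \<Rightarrow> malcev" where
  "N34_coord = (SOME \<psi>. \<psi> \<in> hom N34 malcev_group \<and> (\<forall>x. \<psi> (N34_gen x) = malcev_gen x))"

lemma N34_coord: "N34_coord \<in> hom N34 malcev_group" "N34_coord (N34_gen x) = malcev_gen x"
proof -
  have "\<exists>\<psi>. \<psi> \<in> hom N34 malcev_group \<and> (\<forall>x. \<psi> (N34_gen x) = malcev_gen x)"
    using group_malcev_group lower_central_malcev_3 relators34_malcev by (intro N34_lift) auto
  from someI_ex[OF this]
  show "N34_coord \<in> hom N34 malcev_group" "N34_coord (N34_gen x) = malcev_gen x"
    by (simp_all add: N34_coord_def)
qed

interpretation coord: group_hom N34 malcev_group N34_coord
  by unfold_locales (rule N34_coord)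

lemma coord_commutator3:
  "x \<in> carrier N34 \<Longrightarrow> y \<in> carrier N34 \<Longrightarrow> z \<in> carrier N34 \<Longrightarrow>
    N34_coord (commutator3 N34 x y z) = tri (N34_coord x) (N34_coord y) (N34_coord z)"
  by (simp add: coord.hom_commutator3 commutator3_malcev)

lemma tri_deg2: "tri x y z \<in> malcev_deg2"
  by (simp add: tri_def malcev_deg2_def)

lemma range_N34_gen: "range N34_gen = {N34_gen GenA, N34_gen GenB, N34_gen GenC, N34_gen GenD}"
proof -
  have "UNIV = {GenA, GenB, GenC, GenD}" using gen4.exhaust by auto
  then show ?thesis by (metis image_insert image_empty)
qed

text \<open>The upper bound from the presentation meets the lower bound from the model: five
  elements span the third term, and each is mapped to a coordinate of its own. Identities in the
  third term may thus be checked in coordinates.\<close>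

lemma coord_trivial_kernel:
  assumes u: "u \<in> lower_central N34 2" and one: "N34_coord u = malcev_one"
  shows "u = \<one>\<^bsub>N34\<^esub>"
proof -
  let ?T = "\<lambda>x y z. commutator3 N34 (N34_gen x) (N34_gen y) (N34_gen z)"
  note span = N34.lower_central_2_span[OF N34_gen_closed N34_gen_closed N34_gen_closed N34_gen_closed
      N34_relators N34_generate[unfolded range_N34_gen]]
  from u span obtain i1 i2 i3 i4 i5 :: int where
    eq: "u = ?T GenA GenC GenA [^]\<^bsub>N34\<^esub> i1 \<otimes>\<^bsub>N34\<^esub> (?T GenA GenC GenB [^]\<^bsub>N34\<^esub> i2 \<otimes>\<^bsub>N34\<^esub>
      (?T GenA GenC GenC [^]\<^bsub>N34\<^esub> i3 \<otimes>\<^bsub>N34\<^esub> (?T GenA GenD GenA [^]\<^bsub>N34\<^esub> i4 \<otimes>\<^bsub>N34\<^esub>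
      (?T GenA GenD GenB [^]\<^bsub>N34\<^esub> i5 \<otimes>\<^bsub>N34\<^esub> \<one>\<^bsub>N34\<^esub>))))"
    unfolding N34.adjoin_def by blast
  have "N34_coord (?T x y z [^]\<^bsub>N34\<^esub> i) = scale i (tri (malcev_gen x) (malcev_gen y) (malcev_gen z))"
    for x y z and i :: int
    by (simp add: coord.hom_int_pow N34_gen_closed coord_commutator3 N34_coord malcev_int_pow_deg2 tri_deg2)
  \<comment> \<open>The factor 2 is the doubling of the last five coordinates.\<close>
  then have "N34_coord u = Malcev 0 0 0 0 0 0 0 0 (2 * i1) (2 * i2) (2 * i3) (2 * i4) (2 * i5)"
    unfolding eq by (simp add: N34_gen_closed N34.int_pow_closed tri_def minor_def scale_def malcev_one_def)
  then have "i1 = 0" "i2 = 0" "i3 = 0" "i4 = 0" "i5 = 0" using one by (simp_all add: malcev_one_def)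
  then show ?thesis unfolding eq by simp
qed

lemma coord_inj:
  assumes "u \<in> lower_central N34 2" "v \<in> lower_central N34 2" "N34_coord u = N34_coord v"
  shows "u = v"
proof -
  interpret L: subgroup "lower_central N34 2" N34 by (rule N34.subgroup_lower_central)
  have c: "u \<in> carrier N34" "v \<in> carrier N34" using assms by auto
  have "N34_coord (u \<otimes>\<^bsub>N34\<^esub> inv\<^bsub>N34\<^esub> v) = malcev_one"
    using c assms(3) malcev.r_inv[of "N34_coord v"] coord.hom_inv[OF c(2)] by simp
  then have "u \<otimes>\<^bsub>N34\<^esub> inv\<^bsub>N34\<^esub> v = \<one>\<^bsub>N34\<^esub>"
    using assms by (intro coord_trivial_kernel) auto
  then show ?thesis using c N34.inv_equality N34.inv_inv by (metis N34.inv_closed)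
qed

section \<open>Endomorphisms on the abelianisation\<close>

text \<open>Rational proportionality of the abelianised vectors, cross-multiplied to stay within the
  integers; \<open>proportional 1 x 0 x\<close> says that the vector of \<open>x\<close> is
  zero.\<close>

definition proportional :: "int \<Rightarrow> malcev \<Rightarrow> int \<Rightarrow> malcev \<Rightarrow> bool" where
  "proportional r x s y \<longleftrightarrow>
     r * cA x = s * cA y \<and> r * cB x = s * cB y \<and> r * cC x = s * cC y \<and> r * cD x = s * cD y"

lemma tri_scale:
  "tri (scale r x) y z = scale r (tri x y z)"
  "tri x (scale r y) z = scale r (tri x y z)"
  "tri x y (scale r z) = scale r (tri x y z)"
  by (simp_all add: tri_def scale_def minor_def algebra_simps)

lemma scale_eq_one_iff: "r \<noteq> 0 \<Longrightarrow> scale r x = malcev_one \<longleftrightarrow> x = malcev_one"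
  by (cases x) (simp add: scale_def malcev_one_def)

lemma scale_one [simp]: "scale r malcev_one = malcev_one"
  by (simp add: scale_def malcev_one_def)

text \<open>\<open>tri\<close> is trilinear and reads only the first four coordinates.\<close>

lemma tri_cong:
  assumes "proportional r x s x'"
  shows "scale r (tri x y z) = scale s (tri x' y z)"
    and "scale r (tri y x z) = scale s (tri y x' z)"
    and "scale r (tri y z x) = scale s (tri y z x')"
proof -
  have eq: "tri (scale r x) y z = tri (scale s x') y z"
      "tri y (scale r x) z = tri y (scale s x') z"
      "tri y z (scale r x) = tri y z (scale s x')"
    using assms by (simp_all add: tri_def scale_def minor_def proportional_def)
  show "scale r (tri x y z) = scale s (tri x' y z)"
       "scale r (tri y x z) = scale s (tri y x' z)"
       "scale r (tri y z x) = scale s (tri y z x')"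
    using eq by (simp_all only: tri_scale)
qed

lemma tri_transfer:
  assumes "proportional r x s x'" "r \<noteq> 0"
  shows "tri x' y z = malcev_one \<Longrightarrow> tri x y z = malcev_one"
    and "tri y x' z = malcev_one \<Longrightarrow> tri y x z = malcev_one"
    and "tri y z x' = malcev_one \<Longrightarrow> tri y z x = malcev_one"
  using tri_cong[OF assms(1)] scale_eq_one_iff[OF assms(2)] scale_one by metis+

text \<open>Vanishing minors mean linear dependence. A nonzero coordinate of \<open>y\<close> serves
  as \<open>r\<close> and the same coordinate of \<open>x\<close> as \<open>s\<close>.\<close>

lemma proportional_cases:
  assumes "minor cA cB x y = 0" "minor cA cC x y = 0" "minor cA cD x y = 0"
    "minor cB cC x y = 0" "minor cB cD x y = 0" "minor cC cD x y = 0"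
  obtains "proportional 1 y 0 y" | r s where "r \<noteq> 0" "proportional r x s y"
proof -
  consider "cA y = 0" "cB y = 0" "cC y = 0" "cD y = 0"
    | "cA y \<noteq> 0" | "cB y \<noteq> 0" | "cC y \<noteq> 0" | "cD y \<noteq> 0" by blast
  then show thesis
  proof cases
    case 1 then show ?thesis using that(1) by (simp add: proportional_def)
  next
    case 2 then show ?thesis using that(2)[of "cA y" "cA x"] assms
      by (simp add: proportional_def minor_def mult.commute)
  next
    case 3 then show ?thesis using that(2)[of "cB y" "cB x"] assms
      by (simp add: proportional_def minor_def mult.commute)
  next
    case 4 then show ?thesis using that(2)[of "cC y" "cC x"] assms
      by (simp add: proportional_def minor_def mult.commute)
  next
    case 5 then show ?thesis using that(2)[of "cD y" "cD x"] assms
      by (simp add: proportional_def minor_def mult.commute)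
  qed
qed

lemma tri_zero:
  assumes "proportional 1 x 0 x"
  shows "tri x y z = malcev_one" "tri y x z = malcev_one" "tri y z x = malcev_one"
  using assms by (simp_all add: proportional_def tri_def minor_def malcev_one_def)

text \<open>If \<open>b\<close> vanishes, so does \<open>[b, d, b] = [a, c, a]\<close>; otherwise
  \<open>a\<close> is a rational multiple of \<open>b\<close>, and \<open>[b, c, b] = 1\<close>
  transfers to \<open>[a, c, a]\<close>.\<close>

lemma singular_ab:
  assumes par: "minor cA cB a b = 0" "minor cA cC a b = 0" "minor cA cD a b = 0"
    "minor cB cC a b = 0" "minor cB cD a b = 0" "minor cC cD a b = 0"
    and rel: "tri b c b = malcev_one" "tri a c a = tri b d b"
  shows "tri a c a = malcev_one"
  using par
proof (cases rule: proportional_cases)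
  case 1
  then show ?thesis using tri_zero rel by metis
next
  case (2 r s)
  then show ?thesis using tri_transfer rel(1) by metis
qed

lemma proportional_sym: "proportional r x s y \<Longrightarrow> proportional s y r x"
  by (simp add: proportional_def)

text \<open>In the main case \<open>c\<close> and \<open>d\<close> are nonzero multiples of each
  other and may be exchanged, so triviality propagates along \<open>[a, d, d]\<close>,
  \<open>[a, c, c] = [b, d, c]\<close>, \<open>[b, c, c]\<close>, \<open>[a, d, a]\<close>,
  \<open>[a, c, a]\<close>.\<close>

lemma singular_cd:
  assumes par: "minor cA cB c d = 0" "minor cA cC c d = 0" "minor cA cD c d = 0"
    "minor cB cC c d = 0" "minor cB cD c d = 0" "minor cC cD c d = 0"
    and rel: "tri a d d = malcev_one" "tri a c a = tri b d b" "tri a c c = tri b d c"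
      "tri a d a = malcev_one \<longleftrightarrow> tri b c c = malcev_one"
  shows "tri a c a = malcev_one"
  using par
proof (cases rule: proportional_cases)
  case 1
  then show ?thesis using tri_zero rel(2) by metis
next
  case (2 r s)
  show ?thesis
  proof (cases "s = 0")
    case True
    then have "proportional 1 c 0 c" using 2 by (simp add: proportional_def)
    then show ?thesis using tri_zero by metis
  next
    case False
    note cd = tri_transfer[OF 2(2,1)]
    note dc = tri_transfer[OF proportional_sym[OF 2(2)] False]
    have "tri a c c = malcev_one" using cd rel(1) by metis
    then have "tri b c c = malcev_one" using rel(3) cd by metis
    then show ?thesis using rel(4) cd by metis
  qed
qed

text \<open>Expansions of 3x3 determinants with a repeated row: rows \<open>x\<close>,
  \<open>x\<close>, \<open>y\<close> and \<open>y\<close>, \<open>x\<close>,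
  \<open>y\<close>.\<close>

lemma minor_cramer:
  "cX x * minor cY cZ x y - cY x * minor cX cZ x y + cZ x * minor cX cY x y = 0"
  "cX y * minor cY cZ x y - cY y * minor cX cZ x y + cZ y * minor cX cY x y = 0"
  by (simp_all add: minor_def algebra_simps)

text \<open>A decomposable bivector without mixed components whose \<open>AB\<close> component is
  nonzero spans the second exterior power of P: by \<open>minor_cramer\<close> the \<open>C\<close>
  and \<open>D\<close> coordinates are annihilated by that component.\<close>

lemma minor_AB_imp:
  assumes "minor cA cB x y \<noteq> 0" "minor cA cC x y = 0" "minor cA cD x y = 0"
    "minor cB cC x y = 0" "minor cB cD x y = 0"
  shows "cC x = 0" "cC y = 0" "cD x = 0" "cD y = 0"
  using minor_cramer(1)[of cA x cB cC y] minor_cramer(1)[of cA x cB cD y]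
    minor_cramer(2)[of cA y cB cC x] minor_cramer(2)[of cA y cB cD x] assms by simp_all

lemma minor_CD_imp:
  assumes "minor cC cD x y \<noteq> 0" "minor cA cC x y = 0" "minor cA cD x y = 0"
    "minor cB cC x y = 0" "minor cB cD x y = 0"
  shows "cA x = 0" "cA y = 0" "cB x = 0" "cB y = 0"
  using minor_cramer(1)[of cA x cC cD y] minor_cramer(1)[of cB x cC cD y]
    minor_cramer(2)[of cA y cC cD x] minor_cramer(2)[of cB y cC cD x] assms by simp_all

text \<open>With \<open>a\<close>, \<open>b\<close> in Q and \<open>c\<close>, \<open>d\<close> in
  P, \<open>[b, c, b] = 1\<close> leaves \<open>c\<close> without \<open>B\<close> coordinate and
  \<open>b\<close> without \<open>C\<close> coordinate. Then \<open>P2\<close> vanishes on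
  \<open>[a, c, a]\<close> but not on \<open>[b, d, b]\<close>.\<close>

lemma no_swap:
  assumes b: "cA a = 0" "cB a = 0" "cA b = 0" "cB b = 0" "minor cC cD a b \<noteq> 0"
    and d: "cC c = 0" "cD c = 0" "cC d = 0" "cD d = 0" "minor cA cB c d \<noteq> 0"
    and rel: "tri b c b = malcev_one" "tri a d d = malcev_one" "tri a c a = tri b d b"
  shows False
proof -
  have 1: "cB c * (cD b * cD b) = 0" "cB c * (cC b * cC b) = 0" "cA c * (cC b * cD b) = 0"
      "cA c * (cC b * cC b) + 2 * (cB c * cC b * cD b) = 0"
    using rel(1) b d by (auto simp: tri_def minor_def malcev_one_def)
  have "cC b \<noteq> 0 \<or> cD b \<noteq> 0" using b by (auto simp: minor_def)
  then have Bc: "cB c = 0" using 1 by auto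
  then have Ac: "cA c \<noteq> 0" using d by (auto simp: minor_def)
  then have Cb: "cC b = 0" using 1 Bc by auto
  then have Db: "cD b \<noteq> 0" using b by (auto simp: minor_def)
  have Bd: "cB d \<noteq> 0" using Bc d by (auto simp: minor_def)
  have "cP2 (tri a c a) = 0" using b d Bc by (simp add: tri_def minor_def)
  moreover have "cP2 (tri b d b) = - 2 * (cB d * (cD b * cD b))"
    using b d Cb by (simp add: tri_def minor_def)
  ultimately show False using rel(3) Bd Db by simp
qed

text \<open>\<open>[b, c, b] = 1\<close> and \<open>[a, d, d] = 1\<close> remove the off-diagonal
  entries. For diagonal entries \<open>p, q, r, s\<close> the other relations read
  \<open>p^2 r = q^2 s\<close>, \<open>p r = q s\<close> and \<open>p^2 s = q r^2\<close>, so all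
  four agree.\<close>

lemma diagonal:
  assumes b: "cC a = 0" "cD a = 0" "cC b = 0" "cD b = 0" "minor cA cB a b \<noteq> 0"
    and d: "cA c = 0" "cB c = 0" "cA d = 0" "cB d = 0" "minor cC cD c d \<noteq> 0"
    and rel: "tri b c b = malcev_one" "tri a d d = malcev_one" "tri a c a = tri b d b"
      "tri a c c = tri b d c" "cP4 (tri a d a) = - cP4 (tri b c c)"
  shows "\<exists>l. l \<noteq> 0 \<and> cA a = l \<and> cB a = 0 \<and> cA b = 0 \<and> cB b = l \<and>
    cC c = l \<and> cD c = 0 \<and> cC d = 0 \<and> cD d = l"
proof -
  have 1: "cA b * cA b * cD c = 0" "cA b * cA b * cC c + cB b * cB b * cD c = 0"
    using rel(1) b d by (auto simp: tri_def minor_def malcev_one_def)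
  have cne: "cC c \<noteq> 0 \<or> cD c \<noteq> 0" using d by (auto simp: minor_def)
  have Ab: "cA b = 0" using 1 cne by auto
  then have Aa: "cA a \<noteq> 0" and Bb: "cB b \<noteq> 0" using b by (auto simp: minor_def)
  have Dc: "cD c = 0" using 1 Ab Bb by auto
  then have Cc: "cC c \<noteq> 0" and Dd: "cD d \<noteq> 0" using d by (auto simp: minor_def)
  have 2: "cB a * (cD d * cD d) = 0" "cA a * (cC d * cD d) = 0"
    using rel(2) b d by (auto simp: tri_def minor_def malcev_one_def)
  have Ba: "cB a = 0" and Cd: "cC d = 0" using 2 Dd Aa by auto
  have 3: "cA a * (cA a * cC c) = cB b * (cB b * cD d)"
    using arg_cong[OF rel(3), of cP1] b d Ab Ba Cd Dc by (simp add: tri_def minor_def ac_simps)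
  have "cA a * cC c * cC c = cB b * cD d * cC c"
    using arg_cong[OF rel(4), of cP3] b d Ab Ba Cd Dc by (simp add: tri_def minor_def)
  then have 4: "cA a * cC c = cB b * cD d" using Cc by simp
  then have AB: "cA a = cB b" using 3 Bb Dd by (metis mult_cancel_right mult_eq_0_iff)
  then have CD: "cC c = cD d" using 4 Bb by simp
  have "cA a * cD d * cA a = cB b * cC c * cC c"
    using rel(5) b d Ab Ba Cd Dc by (simp add: tri_def minor_def)
  then have "cA a = cC c" using AB CD Bb Dd by simp
  then show ?thesis using AB CD Ab Ba Cd Dc Aa by auto
qed

lemma endomorphism_dichotomy:
  assumes ab: "minor cA cC a b = 0" "minor cA cD a b = 0" "minor cB cC a b = 0" "minor cB cD a b = 0"
    and cd: "minor cA cC c d = 0" "minor cA cD c d = 0" "minor cB cC c d = 0" "minor cB cD c d = 0"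
    and rel: "tri b c b = malcev_one" "tri a d d = malcev_one" "tri a c a = tri b d b"
      "tri a c c = tri b d c" "tri a d a = scale (- 1) (tri b c c)"
  shows "tri a c a = malcev_one \<or>
    (\<exists>l. l \<noteq> 0 \<and> cA a = l \<and> cB a = 0 \<and> cC a = 0 \<and> cD a = 0 \<and>
      cA b = 0 \<and> cB b = l \<and> cC b = 0 \<and> cD b = 0 \<and>
      cA c = 0 \<and> cB c = 0 \<and> cC c = l \<and> cD c = 0)"
proof -
  have rel5: "tri a d a = malcev_one \<longleftrightarrow> tri b c c = malcev_one"
    using rel(5) scale_eq_one_iff[of "- 1"] by simp
  have rel5': "cP4 (tri a d a) = - cP4 (tri b c c)"
    using rel(5) by (simp add: scale_def)
  \<comment> \<open>Either one of the two bivectors is zero, or a nonzero component of each tells to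
    which summand the pair goes.\<close>
  consider (ab) "minor cA cB a b = 0" "minor cC cD a b = 0"
    | (cd) "minor cA cB c d = 0" "minor cC cD c d = 0"
    | (PP) "minor cA cB a b \<noteq> 0" "minor cA cB c d \<noteq> 0"
    | (PQ) "minor cA cB a b \<noteq> 0" "minor cC cD c d \<noteq> 0"
    | (QP) "minor cC cD a b \<noteq> 0" "minor cA cB c d \<noteq> 0"
    | (QQ) "minor cC cD a b \<noteq> 0" "minor cC cD c d \<noteq> 0" by blast
  then show ?thesis
  proof cases
    case ab then show ?thesis using singular_ab assms by blast
  next
    case cd then show ?thesis using singular_cd assms rel5 by blast
  next
    \<comment> \<open>With all four vectors in one summand every mixed minor vanishes, and with it
      \<open>tri a c a\<close>; likewise for \<open>QQ\<close>.\<close>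
    case PP
    then show ?thesis using minor_AB_imp[OF PP(1) assms(1-4)] minor_AB_imp[OF PP(2) assms(5-8)]
      by (simp add: tri_def minor_def malcev_one_def)
  next
    case QQ
    then show ?thesis using minor_CD_imp[OF QQ(1) assms(1-4)] minor_CD_imp[OF QQ(2) assms(5-8)]
      by (simp add: tri_def minor_def malcev_one_def)
  next
    case PQ
    note z = minor_AB_imp[OF PQ(1) assms(1-4)] minor_CD_imp[OF PQ(2) assms(5-8)]
    from diagonal[OF z(1,3,2,4) PQ(1) z(5,7,6,8) PQ(2) rel(1-4) rel5'] z show ?thesis by auto
  next
    case QP
    note z = minor_CD_imp[OF QP(1) assms(1-4)] minor_AB_imp[OF QP(2) assms(5-8)]
    from no_swap[OF z(1,3,2,4) QP(1) z(5,7,6,8) QP(2) rel(1-3)] show ?thesis ..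
  qed
qed

section \<open>Virtual endomorphisms of $N_{3,4}$\<close>

text \<open>A triple commutator has no coordinates of degree two, so those of the commutator, its
  mixed minors, vanish.\<close>

lemma scale_eq_tri_imp:
  assumes "scale n (malcev_commutator x y) = tri u v w" "n \<noteq> 0"
  shows "minor cA cC x y = 0" "minor cA cD x y = 0" "minor cB cC x y = 0" "minor cB cD x y = 0"
proof -
  have "n * minor cA cC x y = 0" "n * minor cA cD x y = 0" "n * minor cB cC x y = 0" "n * minor cB cD x y = 0"
    using arg_cong[OF assms(1), of cAC] arg_cong[OF assms(1), of cAD]
      arg_cong[OF assms(1), of cBC] arg_cong[OF assms(1), of cBD]
    by (simp_all add: scale_def tri_def malcev_commutator_sel)
  then show "minor cA cC x y = 0" "minor cA cD x y = 0" "minor cB cC x y = 0" "minor cB cD x y = 0"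
    using assms(2) by simp_all
qed

definition N34_pow :: "nat \<Rightarrow> gen4 \<Rightarrow> (gen4 \<times> bool) list set set set" where
  "N34_pow n x = N34_gen x [^]\<^bsub>N34\<^esub> n"

text \<open>Built from powers so that it lies in every subgroup containing them and its image can be
  computed from theirs.\<close>

definition N34_witness :: "nat \<Rightarrow> (gen4 \<times> bool) list set set set" where
  "N34_witness n = commutator3 N34 (N34_pow n GenA) (N34_pow n GenC) (N34_pow n GenA)"

lemma N34_pow_closed [simp]: "N34_pow n x \<in> carrier N34"
  by (simp add: N34_pow_def N34_gen_closed)

lemma coord_pow: "N34_coord (N34_pow n x) = scale (int n) (malcev_gen x)"
  by (simp add: N34_pow_def N34_gen_closed coord.hom_nat_pow N34_coord malcev_gen_pow)

lemma coord_commutator3_pow: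
  "N34_coord (commutator3 N34 (N34_pow n x) (N34_pow n y) (N34_pow n z)) =
    tri (scale (int n) (malcev_gen x)) (scale (int n) (malcev_gen y)) (scale (int n) (malcev_gen z))"
  by (simp add: coord_commutator3 coord_pow)

lemma N34_witness_neq_one:
  assumes "n > 0"
  shows "N34_witness n \<noteq> \<one>\<^bsub>N34\<^esub>"
proof
  assume "N34_witness n = \<one>\<^bsub>N34\<^esub>"
  then have "N34_coord (N34_witness n) = malcev_one" using coord.hom_one by simp
  then show False
    using assms by (simp add: N34_witness_def coord_commutator3_pow tri_def minor_def scale_def malcev_one_def)
qed

text \<open>Homogeneous cubic relators pass to the powers, both sides scaling by \<open>n^3\<close>.
  In the inhomogeneous ones the commutator scales by \<open>n^2\<close> and the triple commutator by
  \<open>n^3\<close>, hence the extra exponent \<open>n\<close>.\<close>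

lemma N34_pow_relations:
  fixes n :: nat
  defines "T \<equiv> \<lambda>x y z. commutator3 N34 (N34_pow n x) (N34_pow n y) (N34_pow n z)"
  shows "T GenB GenC GenB = \<one>\<^bsub>N34\<^esub>" "T GenA GenD GenD = \<one>\<^bsub>N34\<^esub>"
    "T GenA GenC GenA = T GenB GenD GenB" "T GenA GenC GenC = T GenB GenD GenC"
    "T GenA GenD GenA = inv\<^bsub>N34\<^esub> T GenB GenC GenC"
    "commutator N34 (N34_pow n GenA) (N34_pow n GenB) [^]\<^bsub>N34\<^esub> n = T GenA GenC GenC"
    "commutator N34 (N34_pow n GenD) (N34_pow n GenC) [^]\<^bsub>N34\<^esub> n = T GenA GenC GenA"
proof -
  interpret L: subgroup "lower_central N34 2" N34 by (rule N34.subgroup_lower_central)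
  have T2: "T x y z \<in> lower_central N34 2" for x y z
    by (simp add: T_def N34.commutator3_in_2)
  have cT: "N34_coord (T x y z) = tri (scale (int n) (malcev_gen x)) (scale (int n) (malcev_gen y))
      (scale (int n) (malcev_gen z))" for x y z
    by (simp add: T_def coord_commutator3_pow)
  note R = N34.relators34_commutator3[OF N34_gen_closed N34_gen_closed N34_gen_closed N34_gen_closed
      N34_relators]
  \<comment> \<open>\<open>coord_inj\<close> compares elements of the third term only, so
    \<open>[a, b]\<close> and \<open>[d, c]\<close> must be placed there first.\<close>
  have ab: "commutator N34 (N34_gen GenA) (N34_gen GenB) \<in> lower_central N34 2"
    unfolding R(1) by (simp add: N34.commutator3_in_2 N34_gen_closed)
  have "commutator N34 (N34_gen GenC) (N34_gen GenD) \<in> lower_central N34 2"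
    unfolding R(2) by (simp add: N34.commutator3_in_2 N34_gen_closed)
  then have dc: "commutator N34 (N34_gen GenD) (N34_gen GenC) \<in> lower_central N34 2"
    using N34.commutator_swap[of "N34_gen GenC" "N34_gen GenD"] by (simp add: N34_gen_closed)
  have pow: "u [^]\<^bsub>N34\<^esub> n \<in> lower_central N34 2" if "u \<in> lower_central N34 2" for u
    using that N34.subgroup_nat_pow_closed[OF L.subgroup_axioms] by blast
  note simps = cT tri_def minor_def scale_def malcev_one_def
  show "T GenB GenC GenB = \<one>\<^bsub>N34\<^esub>" "T GenA GenD GenD = \<one>\<^bsub>N34\<^esub>"
    by (rule coord_trivial_kernel[OF T2], simp add: simps)+
  show "T GenA GenC GenA = T GenB GenD GenB" "T GenA GenC GenC = T GenB GenD GenC"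
    by (rule coord_inj[OF T2 T2], simp add: simps)+
  show "T GenA GenD GenA = inv\<^bsub>N34\<^esub> T GenB GenC GenC"
    by (rule coord_inj[OF T2 L.m_inv_closed[OF T2]]) (use T2 in \<open>simp add: simps\<close>)
  have cpow: "N34_coord (commutator N34 (N34_pow n x) (N34_pow n y) [^]\<^bsub>N34\<^esub> n) =
      scale (int n) (malcev_commutator (scale (int n) (malcev_gen x)) (scale (int n) (malcev_gen y)))" for x y
    by (simp add: coord.hom_nat_pow coord.hom_commutator coord_pow commutator_malcev
        malcev_pow_deg2 malcev_commutator_sel(5))
  show "commutator N34 (N34_pow n GenA) (N34_pow n GenB) [^]\<^bsub>N34\<^esub> n = T GenA GenC GenC"
    using N34.commutator_nat_pow_in_2[OF N34_gen_closed N34_gen_closed ab]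
    by (intro coord_inj pow T2) (simp_all add: N34_pow_def[symmetric] cpow simps malcev_commutator_def)
  show "commutator N34 (N34_pow n GenD) (N34_pow n GenC) [^]\<^bsub>N34\<^esub> n = T GenA GenC GenA"
    using N34.commutator_nat_pow_in_2[OF N34_gen_closed N34_gen_closed dc]
    by (intro coord_inj pow T2) (simp_all add: N34_pow_def[symmetric] cpow simps malcev_commutator_def)
qed

text \<open>Applying \<open>f\<close> and then coordinates to the relations between the powers puts
  the four image vectors into \<open>endomorphism_dichotomy\<close>. Its first alternative kills the
  witness; the second forces the scalar to be \<open>n\<close>, and the witness is fixed.\<close>

lemma virtual_endomorphism_witness:
  assumes H: "subgroup H N34" and f: "f \<in> hom (N34\<lparr>carrier := H\<rparr>) N34"
    and n: "n > 0" and pow: "\<And>x. N34_pow n x \<in> H"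
  shows "N34_witness n \<in> H" "f (N34_witness n) \<in> {\<one>\<^bsub>N34\<^esub>, N34_witness n}"
proof -
  interpret H: subgroup H N34 by (rule H)
  interpret f: group_hom "N34\<lparr>carrier := H\<rparr>" N34 f
    using f N34.subgroup_imp_group[OF H] by (intro group_hom.intro group_hom_axioms.intro group_N34)
  have KH: "commutator N34 x y \<in> H" if "x \<in> H" "y \<in> H" for x y
    using that by (simp add: commutator_def)
  have fK: "f (commutator N34 x y) = commutator N34 (f x) (f y)" if "x \<in> H" "y \<in> H" for x y
    using that f.hom_commutator[of x y] by (simp add: N34.commutator_restrict[OF H])
  have TH: "commutator3 N34 x y z \<in> H" if "x \<in> H" "y \<in> H" "z \<in> H" for x y z
    using that by (simp add: commutator3_def KH)
  have fT: "f (commutator3 N34 x y z) = commutator3 N34 (f x) (f y) (f z)"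
    if "x \<in> H" "y \<in> H" "z \<in> H" for x y z
    using that by (simp add: commutator3_def fK KH)
  have fcl: "f x \<in> carrier N34" if "x \<in> H" for x using f.hom_closed that by simp
  define F where "F x = N34_coord (f (N34_pow n x))" for x
  define a b c d where abcd: "a = F GenA" "b = F GenB" "c = F GenC" "d = F GenD"
  have FT: "N34_coord (f (commutator3 N34 (N34_pow n x) (N34_pow n y) (N34_pow n z))) = tri (F x) (F y) (F z)"
    for x y z
    by (simp add: F_def fT pow coord_commutator3 fcl)
  have Fpow: "N34_coord (f (commutator N34 (N34_pow n x) (N34_pow n y) [^]\<^bsub>N34\<^esub> n))
      = scale (int n) (malcev_commutator (F x) (F y))" for x y
  proof -
    have "f (u [^]\<^bsub>N34\<^esub> n) = f u [^]\<^bsub>N34\<^esub> n" if "u \<in> H" for u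
      using f.hom_nat_pow[of u n] that by (simp add: N34.nat_pow_consistent[symmetric])
    then show ?thesis
      by (simp add: F_def KH pow fK fcl coord.hom_nat_pow coord.hom_commutator commutator_malcev
          malcev_pow_deg2 malcev_commutator_sel(5))
  qed
  have f1: "N34_coord (f \<one>\<^bsub>N34\<^esub>) = malcev_one" using f.hom_one coord.hom_one by simp
  note rel = N34_pow_relations[of n, THEN arg_cong, of "\<lambda>u. N34_coord (f u)"]
  have r: "tri b c b = malcev_one" "tri a d d = malcev_one" "tri a c a = tri b d b" "tri a c c = tri b d c"
    using rel(1-4) unfolding FT f1 abcd .
  have inv: "N34_coord (f (inv\<^bsub>N34\<^esub> u)) = malcev_inv (N34_coord (f u))" if "u \<in> H" for u
    using f.hom_inv[of u] N34.m_inv_consistent[OF H that] that coord.hom_inv[OF fcl[OF that]] by simp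
  have "tri a d a = malcev_inv (tri b c c)"
    using rel(5) unfolding FT inv[OF TH[OF pow pow pow]] abcd .
  then have r5: "tri a d a = scale (- 1) (tri b c c)" by (simp add: tri_def scale_def)
  have ab: "scale (int n) (malcev_commutator a b) = tri a c c"
    using rel(6) unfolding FT Fpow abcd .
  have dc: "scale (int n) (malcev_commutator d c) = tri a c a"
    using rel(7) unfolding FT Fpow abcd .
  have n0: "int n \<noteq> 0" using n by simp
  \<comment> \<open>The relation concerns \<open>[d, c]\<close>, the dichotomy the pair
    \<open>c\<close>, \<open>d\<close>; only signs change.\<close>
  have minor_swap: "minor s t x y = - minor s t y x" for s t x y by (simp add: minor_def)
  have dichotomy: "tri a c a = malcev_one \<or>
    (\<exists>l. l \<noteq> 0 \<and> cA a = l \<and> cB a = 0 \<and> cC a = 0 \<and> cD a = 0 \<and>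
      cA b = 0 \<and> cB b = l \<and> cC b = 0 \<and> cD b = 0 \<and>
      cA c = 0 \<and> cB c = 0 \<and> cC c = l \<and> cD c = 0)"
    using scale_eq_tri_imp[OF dc n0]
    by (intro endomorphism_dichotomy[OF scale_eq_tri_imp[OF ab n0] _ _ _ _ r r5])
      (simp_all only: minor_swap[of _ _ c d] neg_equal_0_iff_equal)
  show W: "N34_witness n \<in> H" by (simp add: N34_witness_def TH pow)
  have W2: "N34_witness n \<in> lower_central N34 2"
    by (simp add: N34_witness_def N34.commutator3_in_2)
  have fW: "f (N34_witness n) \<in> lower_central N34 2"
    by (simp add: N34_witness_def fT pow N34.commutator3_in_2 fcl)
  have cf: "N34_coord (f (N34_witness n)) = tri a c a" by (simp add: N34_witness_def FT abcd)
  from dichotomy show "f (N34_witness n) \<in> {\<one>\<^bsub>N34\<^esub>, N34_witness n}"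
  proof
    assume "tri a c a = malcev_one"
    then show ?thesis using coord_trivial_kernel[OF fW] cf by simp
  next
    assume "\<exists>l. l \<noteq> 0 \<and> cA a = l \<and> cB a = 0 \<and> cC a = 0 \<and> cD a = 0 \<and>
      cA b = 0 \<and> cB b = l \<and> cC b = 0 \<and> cD b = 0 \<and>
      cA c = 0 \<and> cB c = 0 \<and> cC c = l \<and> cD c = 0"
    then obtain l where l: "l \<noteq> 0" "cA a = l" "cB a = 0" "cC a = 0" "cD a = 0"
      "cA b = 0" "cB b = l" "cC b = 0" "cD b = 0" "cA c = 0" "cB c = 0" "cC c = l" "cD c = 0"
      by blast
    have "int n * cP3 (malcev_commutator a b) = cP3 (tri a c c)"
      using arg_cong[OF ab, of cP3] by (simp add: scale_def)
    \<comment> \<open>The degree comparison: quadratic on the left, cubic on the right, with a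
      common factor 2 cancelled.\<close>
    then have "int n * (l * l) = l * (l * l)"
      using l by (simp add: malcev_commutator_AB tri_def minor_def)
    then have "l = int n" using l(1) by simp
    \<comment> \<open>\<open>tri\<close> sees only abelianised vectors, and those of
      \<open>a\<close> and \<open>c\<close> are now \<open>n\<close> times the generators.\<close>
    then have "tri a c a = N34_coord (N34_witness n)"
      using l by (simp add: N34_witness_def coord_commutator3_pow tri_def minor_def scale_def)
    then show ?thesis using coord_inj[OF fW W2] cf by simp
  qed
qed

theorem theoremD:
  fixes m :: nat
  assumes "m \<ge> 1"
  shows "\<not> (\<exists>\<phi>. \<phi> \<in> hom N34 (tree_aut_group m) \<and> inj_on \<phi> (carrier N34) \<and>
              state_closed m (\<phi> ` carrier N34))"
proof
  assume "\<exists>\<phi>. \<phi> \<in> hom N34 (tree_aut_group m) \<and> inj_on \<phi> (carrier N34) \<and>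
              state_closed m (\<phi> ` carrier N34)"
  then obtain \<phi> where \<phi>: "\<phi> \<in> hom N34 (tree_aut_group m)" and inj: "inj_on \<phi> (carrier N34)"
    and closed: "state_closed m (\<phi> ` carrier N34)" by blast
  define n where "n = (fact m :: nat)"
  have n: "n > 0" by (simp add: n_def)
  let ?H = "\<lambda>y. {g \<in> carrier N34. first_level (\<phi> g) y = y}"
  have pow: "N34_pow n x \<in> ?H y" if "y < m" for x y
    using N34.pow_fact_level_stabilizer[OF \<phi> that N34_gen_closed]
      N34.nat_pow_closed[OF N34_gen_closed] by (simp add: N34_pow_def n_def)
  have "first_level (\<phi> g) y = y \<and> (\<exists>h\<in>{\<one>\<^bsub>N34\<^esub>, N34_witness n}. section_at m (\<phi> g) y = \<phi> h)"
    if g: "g \<in> {\<one>\<^bsub>N34\<^esub>, N34_witness n}" and y: "y < m" for g y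
  proof -
    \<comment> \<open>Each letter has its own \<open>f\<close>, but the two-element set is the same
      for all of them.\<close>
    obtain f where f: "f \<in> hom (N34\<lparr>carrier := ?H y\<rparr>) N34"
      "\<And>g. g \<in> carrier N34 \<Longrightarrow> \<phi> (f g) = section_at m (\<phi> g) y"
      using N34.section_virtual_endomorphism[OF \<phi> inj closed y] by blast
    have H: "subgroup (?H y) N34" by (rule N34.subgroup_level_stabilizer[OF \<phi> y])
    note W = virtual_endomorphism_witness[OF H f(1) n pow[OF y]]
    have "f \<one>\<^bsub>N34\<^esub> = \<one>\<^bsub>N34\<^esub>"
      using hom_one[OF f(1) N34.subgroup_imp_group[OF H] group_N34] by simp
    then have "f g \<in> {\<one>\<^bsub>N34\<^esub>, N34_witness n}" using g W(2) by blast
    moreover have gH: "g \<in> ?H y" using g W(1) subgroup.one_closed[OF H] by blast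
    moreover have "section_at m (\<phi> g) y = \<phi> (f g)" using f(2)[of g] gH by simp
    ultimately show ?thesis by blast
  qed
  moreover have "{\<one>\<^bsub>N34\<^esub>, N34_witness n} \<subseteq> carrier N34" by (simp add: N34_witness_def)
  ultimately have "N34_witness n = \<one>\<^bsub>N34\<^esub>"
    using N34.invariant_set_trivial[OF \<phi> inj, of "{\<one>\<^bsub>N34\<^esub>, N34_witness n}"] by blast
  then show False using N34_witness_neq_one[OF n] by blast
qed

end
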